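(* For every non-empty index $\mathbf k$, \[\sum_{m,n=0}^{\infty}\zeta^{s,t,\star}_{\widehat{\mathcal{RS}}}(\{1\}^m,\mathbf k,\{1\}^n)\,s^mt^n=-\sum_{m,n=0}^{\infty}\overline{\zeta^{s,t,\star}_{\widehat{\mathcal{RS}}}(\{1\}^m,\mathbf k^{\vee},\{1\}^n)}\,s^mt^n,\] where the bar denotes complex conjugation applied coefficientwise in $\mathbb C[[s,t]]$.
   Context: $s,t$ are commuting indeterminates. An index is a finite tuple $\mathbf{k}=(k_1,\dots,k_r)$ of positive integers ($r\ge0$), with $\mathrm{dep}(\mathbf k)=r$, $\mathrm{wt}(\mathbf k)=\sum k_i$; $\{1\}^m$ is $1$ repeated $m$ times; commas denote concatenation. Admissible indices (empty or $k_r\ge2$) have $\zeta(\mathbf k)=\sum_{0<n_1<\cdots<n_r}n_1^{-k_1}\cdots n_r^{-k_r}$. Words: $\mathfrak H=\mathbb Q\langle e_0,e_1\rangle$, $e_{\mathbf{k}}=e_1e_0^{k_1-1}\cdots e_1e_0^{k_r-1}$; for non-empty $\mathbf k$, $\omega(\mathbf k)\in\mathfrak H$ is defined by $e_1\omega(\mathbf k)=e_{\mathbf k}$. $Z^{ш}:(\mathfrak H,ш)\to\mathbb R$ is the unique shuffle-algebra homomorphism with $Z^{ш}(e_{\mathbf k})=(-1)^{\mathrm{dep}(\mathbf k)}\zeta(\mathbf k)$ for admissible $\mathbf k$ and $Z^{ш}(e_0)=Z^{ш}(e_1)=0$ (shuffle regularization). KZ associator: $\Phi_{\mathrm{KZ}}(X_0,X_1)=\sum_{n\ge0}\sum_{a_1,\dots,a_n\in\{0,1\}}Z^{ш}(e_{a_1}\cdots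 e_{a_n})X_{a_n}\cdots X_{a_1}\in\mathbb C\langle\langle X_0,X_1\rangle\rangle$; $\Phi_{\mathrm{KZ}}(A,B)$ denotes substitution $X_0\mapsto A$, $X_1\mapsto B$. Put $\Phi_{\mathcal{RS}}(X_0,X_1)=\exp(\pi iX_0/2)\Phi_{\mathrm{KZ}}(X_1,X_0)\exp(2\pi iX_1)\Phi_{\mathrm{KZ}}(X_0,X_1)\exp(\pi iX_0/2)$. Pairing: for $\Phi=\sum_W c_WW$ (sum over words $W$ in $X_0,X_1$), $\langle\Phi,e_{a_1}\cdots e_{a_n}\rangle$ is the coefficient $c_{X_{a_1}\cdots X_{a_n}}$, extended linearly in the second argument and coefficientwise to $\mathfrak H[[s,t]]$. Refined values: for non-empty $\mathbf k$, $\zeta^{s,t}_{\widehat{\mathcal{RS}}}(\mathbf k)=\frac{(-1)^{\mathrm{wt}(\mathbf k)+\mathrm{dep}(\mathbf k)}}{2\pi i}\bigl\langle\Phi_{\mathcal{RS}}(X_0,X_1),\ (1+e_0s)^{-1}e_1\omega(\mathbf k)e_1(1+e_0t)^{-1}\bigr\rangle\in\mathbb C[[s,t]]$, and $\zeta^{s,t}_{\widehat{\mathcal{RS}}}(\varnothing)=\exp(-(s+t)\pi i/2)$. Star values: $\mathbf l\preceq\mathbf k$ if $\mathbf l$ is obtained from $(k_1\circ\cdots\circ k_r)$ by replacing each $\circ$ by a comma or a plus sign; $\zeta^{s,t,\star}_{\widehat{\mathcal{RS}}}(\mathbf k)=\sum_{\mathbf l\preceq\mathbf k}\zeta^{s,t}_{\widehat{\mathcal{RS}}}(\mathbf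 l)$. Dual index: writing non-empty $\mathbf k=(1+\cdots+1,\dots,1+\cdots+1)$ with $k_i$ ones in block $i$, $\mathbf k^\vee$ is obtained by interchanging commas and plus signs. *)

theory Defs
  imports Complex_Main
begin

text \<open>Words in the letters e0, e1 are encoded as bool lists: False = e0, True = e1.
  Noncommutative series in X0, X1 are encoded as coefficient functions on bool lists
  (False = X0, True = X1).  Power series in the commuting indeterminates s, t are encoded
  as coefficient functions  nat \<Rightarrow> nat \<Rightarrow> complex ,  F a b = coefficient of s^a t^b.
  Indices are nat lists (with positive entries).\<close>

type_synonym word = "bool list"

definition index :: "nat list \<Rightarrow> bool" where
  "index k \<longleftrightarrow> (\<forall>x\<in>set k. 0 < x)"

definition admissible :: "nat list \<Rightarrow> bool" where
  "admissible k \<longleftrightarrow> index k \<and> (k = [] \<or> 2 \<le> last k)"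

definition wt :: "nat list \<Rightarrow> nat" where
  "wt k = sum_list k"

definition dep :: "nat list \<Rightarrow> nat" where
  "dep k = length k"

definition ones :: "nat \<Rightarrow> nat list" where
  "ones m = replicate m 1"

text \<open>zeta_rev ks N for ks = rev k: sum over  0 < n_1 < ... < n_r \<le> N.\<close>
fun zeta_rev :: "nat list \<Rightarrow> nat \<Rightarrow> real" where
  "zeta_rev [] N = 1"
| "zeta_rev (k # ks) N = (\<Sum>n = 1..N. (1 / real n ^ k) * zeta_rev ks (n - 1))"

definition mzv :: "nat list \<Rightarrow> real" where
  "mzv k = lim (\<lambda>N. zeta_rev (rev k) N)"

fun ek :: "nat list \<Rightarrow> word" where
  "ek [] = []"
| "ek (k # ks) = True # replicate (k - 1) False @ ek ks"

text \<open>omega k is defined by  e1 omega(k) = e_k.\<close>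
definition omega :: "nat list \<Rightarrow> word" where
  "omega k = tl (ek k)"

fun shuffle :: "'a list \<Rightarrow> 'a list \<Rightarrow> 'a list list" where
  "shuffle [] v = [v]"
| "shuffle u [] = [u]"
| "shuffle (a # u) (b # v) =
     map (Cons a) (shuffle u (b # v)) @ map (Cons b) (shuffle (a # u) v)"

definition shuffle_hom :: "(word \<Rightarrow> real) \<Rightarrow> bool" where
  "shuffle_hom f \<longleftrightarrow> f [] = 1 \<and>
     (\<forall>u v. f u * f v = sum_list (map f (shuffle u v)))"

definition Zsh :: "word \<Rightarrow> real" where
  "Zsh = (THE f. shuffle_hom f
            \<and> (\<forall>k. k \<noteq> [] \<and> admissible k \<longrightarrow> f (ek k) = (-1) ^ dep k * mzv k)
            \<and> f [False] = 0 \<and> f [True] = 0)"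

definition nc_mult :: "(word \<Rightarrow> complex) \<Rightarrow> (word \<Rightarrow> complex) \<Rightarrow> word \<Rightarrow> complex" where
  "nc_mult F G W = (\<Sum>i = 0..length W. F (take i W) * G (drop i W))"

definition nc_exp :: "complex \<Rightarrow> bool \<Rightarrow> word \<Rightarrow> complex" where
  "nc_exp c b W = (if W = replicate (length W) b then c ^ length W / fact (length W) else 0)"

text \<open>Phi_KZ(X0,X1) = sum Z(e_a1...e_an) X_an ... X_a1 ; coefficient of word W is Z(rev W).\<close>
definition PhiKZ :: "word \<Rightarrow> complex" where
  "PhiKZ W = complex_of_real (Zsh (rev W))"

definition PhiKZ_swap :: "word \<Rightarrow> complex" where
  "PhiKZ_swap W = PhiKZ (map Not W)"

definition PhiRS :: "word \<Rightarrow> complex" where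
  "PhiRS = nc_mult (nc_exp (pi * \<i> / 2) False)
            (nc_mult PhiKZ_swap
              (nc_mult (nc_exp (2 * pi * \<i>) True)
                (nc_mult PhiKZ (nc_exp (pi * \<i> / 2) False))))"

text \<open>(1+e0 s)^{-1} e1 omega(k) e1 (1+e0 t)^{-1}
  = sum_{a,b} (-1)^(a+b) s^a t^b e0^a e1 omega(k) e1 e0^b.\<close>
definition zRS :: "nat list \<Rightarrow> nat \<Rightarrow> nat \<Rightarrow> complex" where
  "zRS k a b =
    (if k = [] then (- pi * \<i> / 2) ^ (a + b) / (fact a * fact b)
     else (-1) ^ (wt k + dep k) / (2 * pi * \<i>) *
          ((-1) ^ (a + b) *
            PhiRS (replicate a False @ [True] @ omega k @ [True] @ replicate b False)))"

fun coarsenings :: "nat list \<Rightarrow> nat list list" where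
  "coarsenings [] = [[]]"
| "coarsenings [k] = [[k]]"
| "coarsenings (k1 # k2 # ks) =
     map (Cons k1) (coarsenings (k2 # ks)) @ coarsenings ((k1 + k2) # ks)"

definition zRS_star :: "nat list \<Rightarrow> nat \<Rightarrow> nat \<Rightarrow> complex" where
  "zRS_star k a b = sum_list (map (\<lambda>l. zRS l a b) (coarsenings k))"

text \<open>Gap pattern of k written as blocks of ones: True = comma, False = plus sign.\<close>
fun gaps :: "nat list \<Rightarrow> bool list" where
  "gaps [] = []"
| "gaps [k] = replicate (k - 1) False"
| "gaps (k # ks) = replicate (k - 1) False @ [True] @ gaps ks"

fun inc_hd :: "nat list \<Rightarrow> nat list" where
  "inc_hd [] = []"
| "inc_hd (x # xs) = Suc x # xs"

fun from_gaps :: "bool list \<Rightarrow> nat list" where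
  "from_gaps [] = [1]"
| "from_gaps (True # g) = 1 # from_gaps g"
| "from_gaps (False # g) = inc_hd (from_gaps g)"

definition dual :: "nat list \<Rightarrow> nat list" where
  "dual k = from_gaps (map Not (gaps k))"

text \<open>Coefficient of s^a t^b in  sum_{m,n} F(m,n)(s,t) s^m t^n.\<close>
definition gen_series :: "(nat \<Rightarrow> nat \<Rightarrow> nat \<Rightarrow> nat \<Rightarrow> complex) \<Rightarrow> nat \<Rightarrow> nat \<Rightarrow> complex" where
  "gen_series F a b = (\<Sum>m\<le>a. \<Sum>n\<le>b. F m n (a - m) (b - n))"

end

theory Submission
  imports Defs "HOL-Complex_Analysis.Complex_Analysis"
begin

text \<open>The series \<open>\<Phi>\<^sub>R\<^sub>S\<close> describes parallel transport of the KZ connection along a loop at 0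
  around 1, with half-turn factors at 0 chosen such that the loop is mapped to its reverse by
  \<open>z \<mapsto> z / (z - 1)\<close>, which fixes 0 and 2 and exchanges 1 and \<open>\<infinity>\<close>. Comparing the boundary values at
  the fixed point 2 of the KZ solution on the upper and the lower half plane gives
  \<open>\<Phi>\<^sub>R\<^sub>S(X\<^sub>0, X\<^sub>1)\<close> as the complex conjugate of \<open>\<Phi>\<^sub>R\<^sub>S(X\<^sub>0, - X\<^sub>0 - X\<^sub>1)\<close>. Under the pairing, this
  substitution is the involution exchanging \<open>e\<^sub>0\<close> and \<open>e\<^sub>0 - e\<^sub>1\<close>. A star value is a pairing with a
  word in \<open>e\<^sub>0\<close> (plus signs) and \<open>e\<^sub>0 - e\<^sub>1\<close> (commas), so the involution turns the word of an index
  into that of its dual, and the two boundary factors of the generating series change sign.\<close>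

section \<open>Noncommutative series and substitutions\<close>

text \<open>\<open>PhiRS\<close> is built from \<open>Zsh\<close>, a definite description that says
  nothing until existence and uniqueness are known. Uniqueness is combinatorial. For existence the
  connection matrix \<open>Phi\<close> of the KZ equation is itself the witness: the equation
  preserves shuffle relations, and the coefficients at admissible words are multiple zeta values.

  Everything is done on coefficients of words, where the KZ equation is triangular, and on slit
  domains with principal logarithms instead of paths. Near 0 the map z / (z - 1) is close to -z, so
  it multiplies the leading behaviour of the solution by exp(-pi i X_0) or exp(pi i X_0), depending
  on the half plane. Write L, M for the values at 2 from above and below, P for the loop around 1
  and \<sigma> for the substitution. Then \<sigma>(M) = L exp(-pi i X_0), \<sigma>(L) = M exp(pi i
  X_0) and M = L P, whence exp(-pi i X_0) \<sigma>(P^-1) = P exp(pi i X_0). The outer factors exp(pi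
  i X_0 / 2) of \<open>PhiRS\<close> share this defect evenly between both sides. Conjugation
  supplies the inverse of P, because \<open>Phi\<close> has real coefficients.\<close>

abbreviation nc_times :: "(word \<Rightarrow> complex) \<Rightarrow> (word \<Rightarrow> complex) \<Rightarrow> word \<Rightarrow> complex" (infixl "\<odot>" 70)
  where "F \<odot> G \<equiv> nc_mult F G"

definition nc_one :: "word \<Rightarrow> complex" where
  "nc_one w = (if w = [] then 1 else 0)"

definition letter :: "bool \<Rightarrow> word \<Rightarrow> complex" where
  "letter a w = (if w = [a] then 1 else 0)"

definition swap :: "(word \<Rightarrow> complex) \<Rightarrow> word \<Rightarrow> complex" where
  "swap F w = F (map Not w)"

lemma nc_mult_Nil [simp]: "(F \<odot> G) [] = F [] * G []"
  by (simp add: nc_mult_def)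

lemma nc_mult_Cons: "(F \<odot> G) (a # w) = F [] * G (a # w) + ((\<lambda>v. F (a # v)) \<odot> G) w"
proof -
  have "(F \<odot> G) (a # w) = (\<Sum>i\<le>Suc (length w). F (take i (a # w)) * G (drop i (a # w)))"
    by (simp add: nc_mult_def atMost_atLeast0)
  also have "\<dots> = F [] * G (a # w) + (\<Sum>i\<le>length w. F (a # take i w) * G (drop i w))"
    by (simp only: sum.atMost_Suc_shift take_0 drop_0 take_Suc_Cons drop_Suc_Cons)
  finally show ?thesis
    by (simp add: nc_mult_def atMost_atLeast0)
qed

lemma nc_mult_add_left: "((\<lambda>w. F w + G w) \<odot> H) w = (F \<odot> H) w + (G \<odot> H) w"
  by (simp add: nc_mult_def ring_distribs sum.distrib)

lemma nc_mult_diff_left: "((\<lambda>w. F w - G w) \<odot> H) w = (F \<odot> H) w - (G \<odot> H) w"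
  by (simp add: nc_mult_def ring_distribs sum_subtractf)

lemma nc_mult_scale_left: "((\<lambda>w. c * F w) \<odot> H) w = c * (F \<odot> H) w"
  by (simp add: nc_mult_def sum_distrib_left mult.assoc)

lemma nc_mult_scale_right: "(F \<odot> (\<lambda>w. c * H w)) w = c * (F \<odot> H) w"
  by (simp add: nc_mult_def sum_distrib_left mult_ac)

lemma nc_mult_zero_left: "((\<lambda>w. 0) \<odot> H) w = 0"
  by (simp add: nc_mult_def)

lemma nc_mult_assoc: "F \<odot> G \<odot> H = F \<odot> (G \<odot> H)"
proof
  fix w
  show "(F \<odot> G \<odot> H) w = (F \<odot> (G \<odot> H)) w"
    by (induction w arbitrary: F)
      (simp_all add: nc_mult_Cons nc_mult_add_left nc_mult_scale_left algebra_simps)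
qed

lemma nc_one_left [simp]: "nc_one \<odot> F = F"
proof
  fix w
  show "(nc_one \<odot> F) w = F w"
    by (cases w) (simp_all add: nc_one_def nc_mult_Cons nc_mult_zero_left)
qed

lemma nc_mult_single_right:
  "(F \<odot> G) w = F w * G [] + (\<Sum>i<length w. F (take i w) * G (drop i w))"
  by (simp add: nc_mult_def atLeast0AtMost lessThan_Suc_atMost[symmetric])

lemma nc_mult_single_left:
  "(F \<odot> G) w = F [] * G w + (\<Sum>i=1..length w. F (take i w) * G (drop i w))"
  by (simp add: nc_mult_def sum.atLeast_Suc_atMost)

lemma nc_one_right [simp]: "F \<odot> nc_one = F"
  by (rule ext) (simp add: nc_mult_single_right nc_one_def)

lemma letter_Nil [simp]: "letter a [] = 0"
  by (simp add: letter_def)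

lemma letter_Cons: "(\<lambda>v. letter a (b # v)) = (if a = b then nc_one else (\<lambda>_. 0))"
  by (auto simp: letter_def nc_one_def fun_eq_iff)

lemma letter_mult_Cons: "(letter a \<odot> F) (b # w) = (if a = b then F w else 0)"
  by (simp add: nc_mult_Cons letter_Cons nc_mult_zero_left)

lemma mult_letter_snoc: "(F \<odot> letter a) (w @ [b]) = (if a = b then F w else 0)"
proof -
  have *: "drop i w @ [b] = [a] \<longleftrightarrow> i = length w \<and> a = b" if "i < Suc (length w)" for i
    using that by (cases "i = length w") auto
  have "(F \<odot> letter a) (w @ [b]) = (\<Sum>i<Suc (length w). F (take i (w @ [b])) * letter a (drop i (w @ [b])))"
    by (simp add: nc_mult_single_right)
  also have "\<dots> = (\<Sum>i<Suc (length w). if i = length w then (if a = b then F w else 0) else 0)"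
    by (intro sum.cong) (auto simp: letter_def *)
  finally show ?thesis
    by simp
qed

lemma nc_mult_left_cancel:
  assumes "F [] = 1" and "F \<odot> A = F \<odot> B"
  shows "A = B"
proof
  fix w
  show "A w = B w"
  proof (induction w rule: length_induct)
    case (1 w)
    have "(F \<odot> A) w = (F \<odot> B) w"
      using assms(2) by simp
    moreover have "(\<Sum>i=1..length w. F (take i w) * A (drop i w)) = (\<Sum>i=1..length w. F (take i w) * B (drop i w))"
      using 1 by (intro sum.cong) auto
    ultimately show ?case
      using assms(1) by (simp add: nc_mult_single_left)
  qed
qed

text \<open>The quotient F^-1 H for F with constant term 1. It yields the constant factor relating
  two solutions of the same differential equation.\<close>

function nc_solve :: "(word \<Rightarrow> complex) \<Rightarrow> (word \<Rightarrow> complex) \<Rightarrow> word \<Rightarrow> complex" where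
  "nc_solve F H w = H w - (\<Sum>i=1..length w. F (take i w) * nc_solve F H (drop i w))"
  by auto
termination
  by (relation "Wellfounded.measure (\<lambda>(F, H, w). length w)") auto

declare nc_solve.simps [simp del]

lemma nc_mult_solve: "F [] = 1 \<Longrightarrow> F \<odot> nc_solve F H = H"
  by (rule ext, subst nc_mult_single_left, subst nc_solve.simps) simp

lemma swap_swap [simp]: "swap (swap F) = F"
  by (simp add: swap_def fun_eq_iff o_def)

lemma swap_mult: "swap (F \<odot> G) = swap F \<odot> swap G"
  by (simp add: swap_def nc_mult_def fun_eq_iff take_map drop_map)

lemma swap_one [simp]: "swap nc_one = nc_one"
  by (simp add: swap_def nc_one_def fun_eq_iff)

lemma swap_exp [simp]: "swap (nc_exp c b) = nc_exp c (\<not> b)"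
proof -
  have "map Not w = replicate (length w) b \<longleftrightarrow> w = replicate (length w) (\<not> b)" for w
    by (induction w) auto
  then show ?thesis
    by (simp add: swap_def nc_exp_def fun_eq_iff)
qed

lemma nc_exp_Nil [simp]: "nc_exp c b [] = 1"
  by (simp add: nc_exp_def)

lemma nc_exp_replicate: "nc_exp c b (replicate n b) = c ^ n / fact n"
  by (simp add: nc_exp_def)

lemma nc_exp_eq_0: "w \<noteq> replicate (length w) b \<Longrightarrow> nc_exp c b w = 0"
  by (simp add: nc_exp_def)

lemma nc_exp_eq_0': "(\<not> b) \<in> set w \<Longrightarrow> nc_exp c b w = 0"
  by (rule nc_exp_eq_0) (metis in_set_replicate)

lemma nc_exp_add: "nc_exp c b \<odot> nc_exp d b = nc_exp (c + d) b"
proof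
  fix w
  show "(nc_exp c b \<odot> nc_exp d b) w = nc_exp (c + d) b w"
  proof (cases "w = replicate (length w) b")
    case True
    define n where "n = length w"
    have w: "w = replicate n b"
      using True by (simp add: n_def)
    have "(nc_exp c b \<odot> nc_exp d b) w = (\<Sum>i\<le>n. c ^ i / fact i * (d ^ (n - i) / fact (n - i)))"
      unfolding nc_mult_def w
      by (intro sum.cong) (auto simp: min_def nc_exp_replicate)
    also have "\<dots> = (\<Sum>i\<le>n. of_nat (n choose i) * c ^ i * d ^ (n - i)) / fact n"
      unfolding sum_divide_distrib
      by (intro sum.cong) (auto simp: binomial_fact)
    also have "\<dots> = (c + d) ^ n / fact n"
      by (simp add: binomial_ring)
    finally show ?thesis
      by (simp add: w nc_exp_replicate)
  next
    case False
    have *: "set v \<subseteq> {b}" if "nc_exp e b v \<noteq> 0" for e v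
      using that nc_exp_eq_0[of v b e] by (metis in_set_replicate singletonI subsetI)
    have "nc_exp c b (take i w) * nc_exp d b (drop i w) = 0" for i
    proof (rule ccontr)
      assume "nc_exp c b (take i w) * nc_exp d b (drop i w) \<noteq> 0"
      then have "set (take i w) \<subseteq> {b}" "set (drop i w) \<subseteq> {b}"
        using * by auto
      then have "set w \<subseteq> {b}"
        by (metis append_take_drop_id set_append Un_subset_iff)
      then have "w = replicate (length w) b"
        using replicate_eqI[of w "length w" b] by auto
      with False show False ..
    qed
    then show ?thesis
      using nc_exp_eq_0[OF False] by (simp only: nc_mult_def sum.neutral_const)
  qed
qed

lemma nc_exp_0: "nc_exp 0 b = nc_one"
  by (auto simp: nc_exp_def nc_one_def fun_eq_iff)

lemma cnj_nc_mult: "cnj ((F \<odot> G) w) = ((\<lambda>v. cnj (F v)) \<odot> (\<lambda>v. cnj (G v))) w"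
  by (simp add: nc_mult_def)

lemma cnj_nc_exp: "cnj (nc_exp c b w) = nc_exp (cnj c) b w"
  by (simp add: nc_exp_def)

text \<open>A pair \<open>(p, q)\<close> stands for the linear form \<open>p e\<^sub>0 + q e\<^sub>1\<close>, a list of pairs for the
  noncommutative product of these forms.\<close>

fun pairing :: "(word \<Rightarrow> complex) \<Rightarrow> (complex \<times> complex) list \<Rightarrow> complex" where
  "pairing F [] = F []"
| "pairing F ((p, q) # x) = pairing (\<lambda>w. p * F (False # w) + q * F (True # w)) x"

abbreviation E0 :: "complex \<times> complex" where "E0 \<equiv> (1, 0)"
abbreviation E1 :: "complex \<times> complex" where "E1 \<equiv> (0, 1)"
abbreviation Ediff :: "complex \<times> complex" where "Ediff \<equiv> (1, - 1)"

lemma pairing_lin: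
  "pairing (\<lambda>w. c * F w + d * G w) x = c * pairing F x + d * pairing G x"
proof (induction x arbitrary: F G)
  case (Cons pq x)
  obtain p q where pq: "pq = (p, q)"
    by force
  have "pairing (\<lambda>w. c * F w + d * G w) (pq # x) =
      pairing (\<lambda>w. c * (p * F (False # w) + q * F (True # w)) + d * (p * G (False # w) + q * G (True # w))) x"
    by (simp add: pq algebra_simps)
  also have "\<dots> = c * pairing F (pq # x) + d * pairing G (pq # x)"
    by (simp only: Cons pq pairing.simps)
  finally show ?case .
qed simp

lemma pairing_scale: "pairing (\<lambda>w. c * F w) x = c * pairing F x"
  using pairing_lin[of c F 0 F x] by simp

lemma pairing_zero: "pairing (\<lambda>w. 0) x = 0"
  using pairing_scale[of 0 "\<lambda>_. 0" x] by simp

lemma pairing_append: "pairing F (x @ y) = pairing (\<lambda>w. pairing (\<lambda>v. F (v @ w)) x) y"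
proof (induction x arbitrary: F)
  case (Cons pq x)
  then show ?case
    by (cases pq) simp
qed simp

lemma pairing_E0_replicate: "pairing F (replicate n E0 @ x) = pairing (\<lambda>w. F (replicate n False @ w)) x"
  by (induction n arbitrary: F) auto

lemma pairing_split: "pairing F (u @ E1 # x) = pairing F (u @ E0 # x) - pairing F (u @ Ediff # x)"
proof -
  have "pairing F (u @ (p, q) # x) = p * pairing F (u @ E0 # x) + q * pairing F (u @ E1 # x)" for p q
    by (simp add: pairing_append pairing_lin)
  from this[of 1 "- 1"] show ?thesis
    by simp
qed

lemma replicate_snoc_Cons: "replicate n x @ x # ys = replicate (Suc n) x @ ys"
  by (simp add: replicate_app_Cons_same)

text \<open>Since e_1 = e_0 - (e_0 - e_1), each summand is a difference of two words that separate a
  block of e_0 from a block of e_0 - e_1, the border moving by one place.\<close>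

lemma pairing_telescope_left:
  "(\<Sum>m\<le>a. pairing F (replicate (a - m) E0 @ E1 # replicate m Ediff @ x)) =
    pairing F (replicate (Suc a) E0 @ x) - pairing F (replicate (Suc a) Ediff @ x)"
proof -
  let ?f = "\<lambda>m. pairing F (replicate (Suc a - m) E0 @ replicate m Ediff @ x)"
  have "pairing F (replicate (a - m) E0 @ E1 # replicate m Ediff @ x) = ?f m - ?f (Suc m)" if "m \<le> a" for m
  proof -
    have "replicate (Suc a - m) E0 @ z = replicate (a - m) E0 @ E0 # z" for z
      using that by (simp only: replicate_snoc_Cons Suc_diff_le)
    then show ?thesis
      by (simp add: pairing_split)
  qed
  then have "(\<Sum>m\<le>a. pairing F (replicate (a - m) E0 @ E1 # replicate m Ediff @ x)) = (\<Sum>m\<le>a. ?f m - ?f (Suc m))"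
    by simp
  also have "\<dots> = ?f 0 - ?f (Suc a)"
    by (rule sum_telescope)
  finally show ?thesis
    by simp
qed

lemma pairing_telescope_right:
  "(\<Sum>n\<le>b. pairing F (x @ replicate n Ediff @ E1 # replicate (b - n) E0)) =
    pairing F (x @ replicate (Suc b) E0) - pairing F (x @ replicate (Suc b) Ediff)"
proof -
  let ?f = "\<lambda>n. pairing F (x @ replicate n Ediff @ replicate (Suc b - n) E0)"
  have "pairing F (x @ replicate n Ediff @ E1 # replicate (b - n) E0) = ?f n - ?f (Suc n)" if "n \<le> b" for n
  proof -
    have "replicate (Suc b - n) E0 = E0 # replicate (b - n) E0"
      using that by (simp add: Suc_diff_le)
    moreover have "replicate (Suc n) Ediff @ z = replicate n Ediff @ Ediff # z" for z :: "(complex \<times> complex) list"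
      by (simp add: replicate_app_Cons_same)
    ultimately show ?thesis
      using pairing_split[of F "x @ replicate n Ediff" "replicate (b - n) E0"] by simp
  qed
  then have "(\<Sum>n\<le>b. pairing F (x @ replicate n Ediff @ E1 # replicate (b - n) E0)) = (\<Sum>n\<le>b. ?f n - ?f (Suc n))"
    by simp
  also have "\<dots> = ?f 0 - ?f (Suc b)"
    by (rule sum_telescope)
  finally show ?thesis
    by simp
qed

text \<open>The substitution \<open>X\<^sub>1 \<mapsto> X\<^sub>\<infinity> = - X\<^sub>0 - X\<^sub>1\<close>, read off on coefficients.\<close>

definition sub_inf :: "(word \<Rightarrow> complex) \<Rightarrow> word \<Rightarrow> complex" where
  "sub_inf F w = pairing F (map (\<lambda>b. if b then (0, - 1) else Ediff) w)"

text \<open>A letter X_0 of the result stems from X_0 or, with sign -1, from the image of X_1; a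
  letter X_1 stems only from the image of X_1. Coefficients are thus read with the transposed
  matrix: e_0 becomes e_0 - e_1, and e_1 becomes - e_1.\<close>

lemma sub_inf_simps [simp]:
  "sub_inf F [] = F []"
  "sub_inf F (False # w) = sub_inf (\<lambda>v. F (False # v) - F (True # v)) w"
  "sub_inf F (True # w) = sub_inf (\<lambda>v. - F (True # v)) w"
  by (simp_all add: sub_inf_def)

lemma sub_inf_lin: "sub_inf (\<lambda>w. c * F w + d * G w) w = c * sub_inf F w + d * sub_inf G w"
  by (simp add: sub_inf_def pairing_lin)

lemma sub_inf_scale: "sub_inf (\<lambda>w. c * F w) w = c * sub_inf F w"
  by (simp add: sub_inf_def pairing_scale)

lemma sub_inf_mult: "sub_inf (F \<odot> G) = sub_inf F \<odot> sub_inf G"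
proof
  fix w
  show "sub_inf (F \<odot> G) w = (sub_inf F \<odot> sub_inf G) w"
  proof (induction w arbitrary: F)
    case (Cons a w)
    show ?case
    proof (cases a)
      case True
      have "sub_inf (F \<odot> G) (a # w) =
          sub_inf (\<lambda>v. F [] * (- G (True # v)) + 1 * (((\<lambda>u. - F (True # u)) \<odot> G) v)) w"
        using True nc_mult_scale_left[of "-1" "\<lambda>u. F (True # u)" G]
        by (simp add: nc_mult_Cons)
      also have "\<dots> = F [] * sub_inf G (a # w) + (sub_inf (\<lambda>u. - F (True # u)) \<odot> sub_inf G) w"
        using True by (simp only: sub_inf_lin Cons) simp
      finally show ?thesis
        using True by (simp add: nc_mult_Cons)
    next
      case False
      have "sub_inf (F \<odot> G) (a # w) =
          sub_inf (\<lambda>v. F [] * (G (False # v) - G (True # v)) + 1 * (((\<lambda>u. F (False # u) - F (True # u)) \<odot> G) v)) w"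
        using False by (simp add: nc_mult_Cons nc_mult_diff_left algebra_simps)
      also have "\<dots> = F [] * sub_inf G (a # w) + (sub_inf (\<lambda>u. F (False # u) - F (True # u)) \<odot> sub_inf G) w"
        using False by (simp only: sub_inf_lin Cons) simp
      finally show ?thesis
        using False by (simp add: nc_mult_Cons)
    qed
  qed simp
qed

lemma sub_inf_id:
  assumes "\<And>w. True \<in> set w \<Longrightarrow> F w = 0"
  shows "sub_inf F = F"
proof
  fix w
  show "sub_inf F w = F w"
    using assms
  proof (induction w arbitrary: F)
    case (Cons a w)
    have F1: "F (True # v) = 0" for v
      using Cons.prems by simp
    show ?case
    proof (cases a)
      case True
      then show ?thesis
        using F1 by (simp add: sub_inf_def pairing_zero)
    next
      case False
      then show ?thesis
        using F1 Cons by simp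
    qed
  qed simp
qed

lemma sub_inf_exp [simp]: "sub_inf (nc_exp c False) = nc_exp c False"
  by (rule sub_inf_id) (simp add: nc_exp_eq_0')

lemma pairing_sub_inf: "pairing (sub_inf F) x = pairing F (map (\<lambda>(p, q). (p, - p - q)) x)"
proof (induction x arbitrary: F)
  case (Cons pq x)
  obtain p q where pq: "pq = (p, q)"
    by force
  have "(\<lambda>w. p * sub_inf F (False # w) + q * sub_inf F (True # w)) =
      sub_inf (\<lambda>w. p * (F (False # w) - F (True # w)) + q * (- F (True # w)))"
    by (rule ext) (simp only: sub_inf_simps sub_inf_lin)
  then have "pairing (sub_inf F) (pq # x) =
      pairing (\<lambda>w. p * (F (False # w) - F (True # w)) + q * (- F (True # w))) (map (\<lambda>(p, q). (p, - p - q)) x)"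
    by (simp only: pq pairing.simps Cons)
  then show ?case
    by (simp add: pq algebra_simps)
qed simp

section \<open>Shuffle characters and indices\<close>

text \<open>The linear extension of F evaluated at the shuffle product of u and v. Keeping F as an
  argument turns the removal of a first or last letter into a change of F, which suits
  induction.\<close>

definition sh :: "('a list \<Rightarrow> 'b::comm_monoid_add) \<Rightarrow> 'a list \<Rightarrow> 'a list \<Rightarrow> 'b" where
  "sh F u v = sum_list (map F (shuffle u v))"

lemma sh_Nil [simp]: "sh F [] v = F v" "sh F u [] = F u"
  by (simp_all add: sh_def) (cases u; simp)

lemma sh_Cons:
  "sh F (a # u) (b # v) = sh (\<lambda>w. F (a # w)) u (b # v) + sh (\<lambda>w. F (b # w)) (a # u) v"
  by (simp add: sh_def o_def)

lemma sh_map: "sh F (map f u) (map f v) = sh (\<lambda>w. F (map f w)) u v"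
  by (induction u v arbitrary: F rule: shuffle.induct) (simp_all add: sh_Cons)

lemma sh_add: "sh (\<lambda>w. F w + G w) u v = sh F u v + sh G u v"
  by (simp add: sh_def sum_list_addf)

lemma sh_scale: "sh (\<lambda>w. c * F w) u v = c * sh F u v" for c :: "'a::semiring_0"
  by (simp add: sh_def sum_list_const_mult)

lemma sh_commute: "sh F u v = sh F v u"
proof (induction u v arbitrary: F rule: shuffle.induct)
  case (3 a u b v)
  show ?case
    by (simp only: sh_Cons 3 add.commute)
qed simp_all

lemma sh_single_snoc: "sh F [a] (v @ [b]) = F (v @ [b, a]) + sh (\<lambda>w. F (w @ [b])) [a] v"
  by (induction v arbitrary: F) (simp_all add: sh_Cons ac_simps)

text \<open>The shuffle recursion can equally be run from the last letters. This gives invariance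
  under reversal, needed because \<open>PhiKZ\<close> reads words backwards.\<close>

lemma sh_snoc:
  "sh F (u @ [a]) (v @ [b]) = sh (\<lambda>w. F (w @ [a])) u (v @ [b]) + sh (\<lambda>w. F (w @ [b])) (u @ [a]) v"
proof (induction u v arbitrary: F rule: shuffle.induct)
  case (1 v)
  then show ?case
    by (simp add: sh_single_snoc)
next
  case (2 c u)
  then show ?case
    using sh_single_snoc[of F b "c # u" a] sh_commute[of F "c # u @ [a]" "[b]"]
      sh_commute[of "\<lambda>w. F (w @ [a])" "c # u" "[b]"] by (simp add: add.commute)
next
  case (3 c u d v)
  then show ?case
    by (simp add: sh_Cons ac_simps)
qed

lemma sh_rev: "sh (\<lambda>w. F (rev w)) u v = sh F (rev u) (rev v)"
proof (induction u v arbitrary: F rule: shuffle.induct)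
  case (3 a u b v)
  then show ?case
    using 3(1)[of "\<lambda>w. F (w @ [a])"] 3(2)[of "\<lambda>w. F (w @ [b])"] by (simp add: sh_Cons sh_snoc)
qed simp_all

lemma sh_single: "sh F [a] v = (\<Sum>i\<le>length v. F (take i v @ a # drop i v))"
proof (induction v arbitrary: F)
  case (Cons b v)
  then show ?case
    by (simp add: sh_Cons sum.atMost_Suc_shift del: sum.atMost_Suc)
qed simp

text \<open>Shuffle and deconcatenation are compatible: cutting a shuffle of u and v in two gives a
  shuffle of prefixes followed by a shuffle of suffixes.\<close>

lemma sh_mult:
  "sh (F \<odot> G) u v =
    (\<Sum>i\<le>length u. \<Sum>j\<le>length v. sh F (take i u) (take j v) * sh G (drop i u) (drop j v))"
proof (induction u v arbitrary: F rule: shuffle.induct)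
  case (1 v)
  then show ?case
    by (simp add: nc_mult_def atLeast0AtMost)
next
  case (2 a u)
  then show ?case
    by (simp add: nc_mult_def atLeast0AtMost del: sum.atMost_Suc)
next
  case (3 a u b v)
  let ?T = "\<lambda>i j. sh F (take i (a # u)) (take j (b # v)) * sh G (drop i (a # u)) (drop j (b # v))"
  let ?Fa = "\<lambda>w. F (a # w)" and ?Fb = "\<lambda>w. F (b # w)"
  let ?A = "\<lambda>i j. sh ?Fa (take i u) (take j (b # v)) * sh G (drop i u) (drop j (b # v))"
  let ?B = "\<lambda>i j. sh ?Fb (take i (a # u)) (take j v) * sh G (drop i (a # u)) (drop j v)"
  have 1: "?T (Suc i) 0 = ?A i 0" "?T 0 (Suc j) = ?B 0 j"
    "?T (Suc i) (Suc j) = ?A i (Suc j) + ?B (Suc i) j" for i j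
    by (simp_all add: sh_Cons ring_distribs)
  have "(\<Sum>i\<le>length (a # u). \<Sum>j\<le>length (b # v). ?T i j) =
      ?T 0 0 + (\<Sum>j\<le>length v. ?T 0 (Suc j)) +
        (\<Sum>i\<le>length u. ?T (Suc i) 0 + (\<Sum>j\<le>length v. ?T (Suc i) (Suc j)))"
    by (simp only: list.size(4) add_Suc_right add_0_right sum.atMost_Suc_shift add.assoc)
  also have "\<dots> = ?T 0 0 + (\<Sum>i\<le>length u. ?A i 0 + (\<Sum>j\<le>length v. ?A i (Suc j)))
      + ((\<Sum>j\<le>length v. ?B 0 j) + (\<Sum>i\<le>length u. \<Sum>j\<le>length v. ?B (Suc i) j))"
    by (simp only: 1 sum.distrib add_ac)
  also have "\<dots> = ?T 0 0 + (\<Sum>i\<le>length u. \<Sum>j\<le>length (b # v). ?A i j)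
      + (\<Sum>i\<le>length (a # u). \<Sum>j\<le>length v. ?B i j)"
    by (simp only: list.size(4) add_Suc_right add_0_right sum.atMost_Suc_shift)
  also have "\<dots> = F [] * sh G (a # u) (b # v) + sh (?Fa \<odot> G) u (b # v) + sh (?Fb \<odot> G) (a # u) v"
    by (simp only: 3) simp
  also have "\<dots> = sh (F \<odot> G) (a # u) (b # v)"
    by (simp add: sh_Cons nc_mult_Cons sh_add sh_scale algebra_simps)
  finally show ?case ..
qed

text \<open>Group-like series, expressed through their coefficients.\<close>

definition nc_char :: "(word \<Rightarrow> complex) \<Rightarrow> bool" where
  "nc_char F \<longleftrightarrow> F [] = 1 \<and> (\<forall>u v. F u * F v = sh F u v)"

lemma nc_charD: "nc_char F \<Longrightarrow> F [] = 1" "nc_char F \<Longrightarrow> sh F u v = F u * F v"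
  by (simp_all add: nc_char_def)

lemma nc_mult_times_nc_mult:
  "(F \<odot> G) u * (F \<odot> G) v =
    (\<Sum>i\<le>length u. \<Sum>j\<le>length v. (F (take i u) * F (take j v)) * (G (drop i u) * G (drop j v)))"
  by (simp add: nc_mult_def atLeast0AtMost sum_product mult_ac)

text \<open>By \<open>sh_mult\<close> the defect of the product is a combination of defects of C at
  pairs of suffixes. By induction on the total length only the term with both prefixes empty can
  survive, and that is the defect of C at (u, v) itself.\<close>

lemma nc_char_cancel:
  assumes "nc_char A" and AC: "nc_char (A \<odot> C)"
  shows "nc_char C"
proof -
  note A = nc_charD[OF assms(1)]
  have C1: "C [] = 1"
    using nc_charD(1)[OF AC] A by simp
  define D where "D u v = C u * C v - sh C u v" for u v
  have "D u v = 0" for u v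
  proof (induction "length u + length v" arbitrary: u v rule: less_induct)
    case less
    have "(A \<odot> C) u * (A \<odot> C) v - sh (A \<odot> C) u v = 0"
      using AC by (simp add: nc_char_def)
    then have "(\<Sum>i\<le>length u. \<Sum>j\<le>length v. A (take i u) * A (take j v) * D (drop i u) (drop j v)) = 0"
      by (simp add: sh_mult nc_mult_times_nc_mult A D_def ring_distribs sum_subtractf mult_ac)
    also have "(\<Sum>i\<le>length u. \<Sum>j\<le>length v. A (take i u) * A (take j v) * D (drop i u) (drop j v)) =
        (\<Sum>i\<le>length u. \<Sum>j\<le>length v. if j = 0 then if i = 0 then D u v else 0 else 0)"
    proof (intro sum.cong refl)
      fix i j assume ij: "i \<in> {..length u}" "j \<in> {..length v}"
      then have "length (drop i u) + length (drop j v) < length u + length v" if "i \<noteq> 0 \<or> j \<noteq> 0"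
        using that by auto
      then show "A (take i u) * A (take j v) * D (drop i u) (drop j v) =
          (if j = 0 then if i = 0 then D u v else 0 else 0)"
        using less[of "drop i u" "drop j v"] A(1) by (cases "i = 0 \<and> j = 0") auto
    qed
    finally show ?case
      by simp
  qed
  then show ?thesis
    using C1 by (simp add: nc_char_def D_def)
qed

lemma nc_char_swap: "nc_char F \<Longrightarrow> nc_char (swap F)"
  by (simp add: nc_char_def sh_map swap_def[abs_def])

lemma shuffle_set_length:
  "w \<in> set (shuffle u v) \<Longrightarrow> set w = set u \<union> set v \<and> length w = length u + length v"
  by (induction u v arbitrary: w rule: shuffle.induct) auto

lemma length_shuffle: "length (shuffle u v) = (length u + length v) choose length u"
  by (induction u v rule: shuffle.induct) simp_all

lemma replicate_if_subset: "set w \<subseteq> {b} \<Longrightarrow> w = replicate (length w) b"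
  by (induction w) auto

text \<open>On powers of one letter all shuffles coincide, and their number, a binomial coefficient,
  matches the quotient of factorials. On other pairs of words both sides vanish.\<close>

lemma nc_char_exp: "nc_char (nc_exp c b)"
proof -
  have "sh (nc_exp c b) u v = nc_exp c b u * nc_exp c b v" for u v
  proof (cases "set u \<union> set v \<subseteq> {b}")
    case True
    define m n where "m = length u" and "n = length v"
    have uv: "u = replicate m b" "v = replicate n b"
      using True by (auto simp: m_def n_def intro: replicate_if_subset)
    have "nc_exp c b w = c ^ (m + n) / fact (m + n)" if "w \<in> set (shuffle u v)" for w
    proof -
      have "w = replicate (m + n) b"
        using shuffle_set_length[OF that] replicate_if_subset[of w b] True by (simp add: m_def n_def)
      then show ?thesis
        by (simp add: nc_exp_replicate)
    qed
    then have "sh (nc_exp c b) u v = of_nat (length (shuffle u v)) * (c ^ (m + n) / fact (m + n))"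
      unfolding sh_def by (simp add: sum_list_triv cong: map_cong)
    also have "\<dots> = c ^ m / fact m * (c ^ n / fact n)"
      by (simp add: length_shuffle m_def[symmetric] n_def[symmetric] binomial_fact power_add)
    finally show ?thesis
      by (simp add: uv nc_exp_replicate)
  next
    case False
    then obtain x where "x \<in> set u \<union> set v" "x \<noteq> b"
      by blast
    moreover from this have "x = (\<not> b)"
      by simp
    ultimately have "(\<not> b) \<in> set u \<union> set v"
      by simp
    moreover from this have "nc_exp c b w = 0" if "w \<in> set (shuffle u v)" for w
      using shuffle_set_length[OF that] by (intro nc_exp_eq_0') simp
    then have "sh (nc_exp c b) u v = 0"
      by (simp add: sh_def cong: map_cong)
    ultimately show ?thesis
      using nc_exp_eq_0'[of b u c] nc_exp_eq_0'[of b v c] by auto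
  qed
  then show ?thesis
    by (simp add: nc_char_def)
qed

text \<open>Shuffling a word with a single letter shortens the block of leading \<open>e\<^sub>0\<close> or of trailing
  \<open>e\<^sub>1\<close>; in a shuffle-regularised map these products vanish, which reduces every word to words
  of the form \<open>e\<^sub>1 \<dots> e\<^sub>0\<close>.\<close>

lemma regularisation_unique:
  fixes d :: "word \<Rightarrow> real"
  assumes ins: "\<And>a v. (\<Sum>i\<le>length v. d (take i v @ a # drop i v)) = 0"
    and adm: "\<And>u. d (True # u @ [False]) = 0" and Nil: "d [] = 0"
  shows "d w = 0"
proof -
  \<comment> \<open>All insertions of a into a power of a give the same word, so the vanishing sum
    is a positive multiple of one value.\<close>
  have rep: "d (replicate n a) = 0" for n a
  proof (cases n)
    case (Suc m)
    have "(\<Sum>i\<le>m. d (take i (replicate m a) @ a # drop i (replicate m a))) = (\<Sum>i\<le>m. d (replicate n a))"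
      by (intro sum.cong refl arg_cong[where f = d])
        (simp add: Suc min_def replicate_add[symmetric] flip: replicate_Suc)
    then show ?thesis
      using ins[of "replicate m a" a] by simp
  qed (simp add: Nil)
  \<comment> \<open>Inserting e_1 before the last e_0 gives words with only m trailing e_1, covered
    by induction for another x; the other m + 1 positions all give the word in question.\<close>
  have tru: "d (True # x @ False # replicate m True) = 0" for m x
  proof (induction m arbitrary: x)
    case (Suc m)
    let ?v = "True # x @ False # replicate m True" and ?N = "Suc (Suc (length x))"
    have "(\<Sum>i\<le>length ?v. d (take i ?v @ True # drop i ?v)) =
        (\<Sum>i\<le>length ?v. if i < ?N then 0 else d (True # x @ False # replicate (Suc m) True))"
    proof (intro sum.cong refl)
      fix i assume i: "i \<in> {..length ?v}"
      consider "i = 0" | j where "i = Suc j" "j \<le> length x" | j where "i = ?N + j" "j \<le> m"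
      proof (cases "i < ?N")
        case True
        then show ?thesis
          using that(1,2) by (cases i) auto
      next
        case False
        then have "i = ?N + (i - ?N)"
          by simp
        moreover have "i - ?N \<le> m"
          using i False by simp
        ultimately show ?thesis
          using that(3) by blast
      qed
      then show "d (take i ?v @ True # drop i ?v) =
          (if i < ?N then 0 else d (True # x @ False # replicate (Suc m) True))"
      proof cases
        case 1
        then show ?thesis
          using Suc[of "True # x"] by simp
      next
        case 2
        then show ?thesis
          using Suc[of "take j x @ True # drop j x"] by simp
      next
        case 3
        have "replicate j True @ True # replicate (m - j) True = replicate (Suc m) True"
          using 3 by (simp add: replicate_app_Cons_same replicate_add[symmetric] del: replicate_Suc flip: replicate_Suc)
        then show ?thesis
          using 3 by (simp add: min_def)
      qed
    qed
    also have "\<dots> = real (Suc m) * d (True # x @ False # replicate (Suc m) True)"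
    proof -
      have "(\<Sum>i\<le>length ?v. if i < ?N then 0 else c) = (\<Sum>i\<in>{?N..?N + m}. c)" for c :: real
        by (rule sum.mono_neutral_cong_right) auto
      then show ?thesis
        by (simp del: replicate_Suc sum.atMost_Suc)
    qed
    finally show ?case
      using ins[of ?v True] by simp
  qed (simp add: adm)
  have start_True: "d (True # x) = 0" for x
  proof (cases "False \<in> set x")
    case True
    then obtain y z where "x = y @ False # z" "False \<notin> set z"
      by (meson split_list_last)
    moreover from this have "z = replicate (length z) True"
      by (intro replicate_if_subset) (metis (full_types) insertI1 subsetI)
    ultimately show ?thesis
      using tru[of y "length z"] by metis
  next
    case False
    then have "True # x = replicate (length (True # x)) True"
      by (intro replicate_if_subset) (metis (full_types) insertI1 set_ConsD subsetI)
    from arg_cong[where f = d, OF this] show ?thesis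
      by (simp only: rep)
  qed
  \<comment> \<open>The mirror argument: the n + 1 insertions of e_0 into or next to the leading
    block coincide, later ones leave only n leading e_0.\<close>
  have fal: "d (replicate n False @ True # x) = 0" for n x
  proof (induction n arbitrary: x)
    case (Suc n)
    let ?v = "replicate n False @ True # x"
    have "(\<Sum>i\<le>length ?v. d (take i ?v @ False # drop i ?v)) =
        (\<Sum>i\<le>length ?v. if i \<le> n then d (replicate (Suc n) False @ True # x) else 0)"
    proof (intro sum.cong refl)
      fix i assume i: "i \<in> {..length ?v}"
      show "d (take i ?v @ False # drop i ?v) =
          (if i \<le> n then d (replicate (Suc n) False @ True # x) else 0)"
      proof (cases "i \<le> n")
        case True
        then have "replicate i False @ False # replicate (n - i) False = replicate (Suc n) False"
          by (simp flip: replicate_Suc replicate_add)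
        then have "replicate i False @ False # replicate (n - i) False @ True # x = replicate (Suc n) False @ True # x"
          by (metis append_Cons append_assoc)
        moreover have "take i ?v @ False # drop i ?v = replicate i False @ False # replicate (n - i) False @ True # x"
          using True by (simp add: min_def)
        ultimately show ?thesis
          using True by (simp only: if_True)
      next
        case False
        then obtain j where "i = Suc (n + j)"
          using less_imp_Suc_add[of n i] by auto
        then show ?thesis
          using Suc[of "take j x @ False # drop j x"] by simp
      qed
    qed
    also have "\<dots> = real (Suc n) * d (replicate (Suc n) False @ True # x)"
    proof -
      have "(\<Sum>i\<le>length ?v. if i \<le> n then c else 0) = (\<Sum>i\<in>{..n}. c)" for c :: real
        by (rule sum.mono_neutral_cong_right) auto
      then show ?thesis
        by (simp del: replicate_Suc)
    qed
    finally show ?case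
      using ins[of ?v False] by simp
  qed (simp add: start_True)
  show ?thesis
  proof (cases "True \<in> set w")
    case True
    then obtain y z where "w = y @ True # z" "True \<notin> set y"
      by (meson split_list_first)
    moreover from this have "y = replicate (length y) False"
      by (intro replicate_if_subset) (metis (full_types) insertI1 subsetI)
    ultimately show ?thesis
      using fal[of "length y" z] by metis
  next
    case False
    then have "w = replicate (length w) False"
      by (intro replicate_if_subset) (metis (full_types) insertI1 subsetI)
    from arg_cong[where f = d, OF this] show ?thesis
      by (simp only: rep)
  qed
qed

section \<open>Words of indices, duality and coarsenings, and the characterisation of
  \<open>Zsh\<close>\<close>

lemma gaps_Cons: "ks \<noteq> [] \<Longrightarrow> gaps (k # ks) = replicate (k - 1) False @ True # gaps ks"
  by (cases ks) auto

lemma ek_eq: "k \<noteq> [] \<Longrightarrow> ek k = True # gaps k"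
  by (induction k rule: gaps.induct) auto

lemma omega_eq: "k \<noteq> [] \<Longrightarrow> omega k = gaps k"
  by (simp add: omega_def ek_eq)

lemma ek_append: "ek (k @ l) = ek k @ ek l"
  by (induction k) auto

lemma gaps_snoc_1: "k \<noteq> [] \<Longrightarrow> gaps (k @ [1]) = gaps k @ [True]"
  by (induction k rule: gaps.induct) auto

lemma from_gaps_nonempty: "from_gaps g \<noteq> []"
  by (induction g rule: from_gaps.induct) (auto simp: neq_Nil_conv)

lemma index_from_gaps: "index (from_gaps g)"
proof (induction g rule: from_gaps.induct)
  case (3 g)
  then show ?case
    by (cases "from_gaps g") (auto simp: index_def)
qed (auto simp: index_def)

lemma gaps_from_gaps: "gaps (from_gaps g) = g"
proof (induction g rule: from_gaps.induct)
  case (2 g)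
  then show ?case
    by (simp add: gaps_Cons from_gaps_nonempty)
next
  case (3 g)
  obtain k ks where k: "from_gaps g = k # ks"
    using from_gaps_nonempty by (meson neq_Nil_conv)
  moreover have "replicate k False = False # replicate (k - 1) False"
    using index_from_gaps[of g] k by (cases k) (simp_all add: index_def)
  ultimately show ?case
    using 3 by (cases ks) auto
qed simp

lemma wt_gaps: "index k \<Longrightarrow> k \<noteq> [] \<Longrightarrow> wt k = Suc (length (gaps k))"
  by (induction k rule: gaps.induct) (auto simp: index_def wt_def)

lemma gaps_dual: "gaps (dual k) = map Not (gaps k)"
  by (simp add: dual_def gaps_from_gaps)

lemma dual_nonempty: "dual k \<noteq> []"
  by (simp add: dual_def from_gaps_nonempty)

lemma index_dual: "index (dual k)"
  by (simp add: dual_def index_from_gaps)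

lemma wt_dual: "index k \<Longrightarrow> k \<noteq> [] \<Longrightarrow> wt (dual k) = wt k"
  by (simp add: wt_gaps index_dual dual_nonempty gaps_dual)

lemma admissible_ek:
  obtains k where "k \<noteq> []" "admissible k" "ek k = True # u @ [False]"
proof
  let ?k = "from_gaps (u @ [False])"
  show k: "?k \<noteq> []"
    by (rule from_gaps_nonempty)
  show ek: "ek ?k = True # u @ [False]"
    by (simp add: ek_eq k gaps_from_gaps)
  have "last ?k \<noteq> 1"
  proof
    assume "last ?k = 1"
    then have "?k = butlast ?k @ [1]"
      using k by (metis append_butlast_last_id)
    then have "ek ?k = ek (butlast ?k) @ ek [1]"
      by (metis ek_append)
    then have "ek ?k = ek (butlast ?k) @ [True]"
      by simp
    then have "last (ek ?k) = True"
      by simp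
    then show False
      unfolding ek by simp
  qed
  moreover have "0 < last ?k"
    using index_from_gaps[of "u @ [False]"] k unfolding index_def by auto
  ultimately show "admissible ?k"
    using index_from_gaps by (auto simp: admissible_def)
qed

text \<open>A difference of two shuffle homomorphisms is not multiplicative. But both vanish on
  products with a single letter, and this linear property passes to the difference; it is all that
  \<open>regularisation_unique\<close> asks for.\<close>

lemma Zsh_eqI:
  assumes hom: "shuffle_hom f"
    and adm: "\<And>k. k \<noteq> [] \<Longrightarrow> admissible k \<Longrightarrow> f (ek k) = (-1) ^ dep k * mzv k"
    and letters: "f [False] = 0" "f [True] = 0"
  shows "Zsh = f"
  unfolding Zsh_def
proof (rule the_equality)
  fix g
  assume g: "shuffle_hom g \<and> (\<forall>k. k \<noteq> [] \<and> admissible k \<longrightarrow> g (ek k) = (-1) ^ dep k * mzv k)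
    \<and> g [False] = 0 \<and> g [True] = 0"
  have 0: "(\<Sum>i\<le>length v. f' (take i v @ a # drop i v)) = 0"
    if "shuffle_hom f'" "f' [False] = 0" "f' [True] = 0" for f' a v
  proof -
    have "(\<Sum>i\<le>length v. f' (take i v @ a # drop i v)) = f' [a] * f' v"
      using that(1) by (simp add: shuffle_hom_def sh_single[symmetric] sh_def)
    then show ?thesis
      using that(2,3) by (cases a) auto
  qed
  show "g = f"
  proof
    fix w
    have "g w - f w = 0"
    proof (rule regularisation_unique[of "\<lambda>w. g w - f w"])
      show "g (True # u @ [False]) - f (True # u @ [False]) = 0" for u
      proof -
        obtain k where "k \<noteq> []" "admissible k" "ek k = True # u @ [False]"
          by (rule admissible_ek)
        then show ?thesis
          using g adm[of k] by auto
      qed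
    qed (use 0 hom g letters in \<open>auto simp: sum_subtractf shuffle_hom_def\<close>)
    then show "g w = f w"
      by simp
  qed
qed (use assms in auto)

lemma coarsenings_index:
  "k \<noteq> [] \<Longrightarrow> index k \<Longrightarrow> l \<in> set (coarsenings k) \<Longrightarrow> l \<noteq> [] \<and> index l \<and> wt l = wt k"
proof (induction k arbitrary: l rule: coarsenings.induct)
  case (3 k1 k2 ks)
  have index: "index (k2 # ks)" "index ((k1 + k2) # ks)" "0 < k1"
    using 3(4) by (auto simp: index_def)
  have "l \<in> Cons k1 ` set (coarsenings (k2 # ks)) \<or> l \<in> set (coarsenings ((k1 + k2) # ks))"
    using 3(5) by simp
  then show ?case
  proof
    assume "l \<in> Cons k1 ` set (coarsenings (k2 # ks))"
    then obtain l' where "l = k1 # l'" "l' \<in> set (coarsenings (k2 # ks))"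
      by (rule imageE)
    then show ?thesis
      using 3(1)[OF _ index(1)] index(3) by (simp add: index_def wt_def)
  next
    assume "l \<in> set (coarsenings ((k1 + k2) # ks))"
    then show ?thesis
      using 3(2)[OF _ index(2)] by (simp add: wt_def)
  qed
qed simp_all

definition star_letter :: "bool \<Rightarrow> complex \<times> complex" where
  "star_letter b = (if b then Ediff else E0)"

text \<open>A comma of k is either kept, giving e_1 and a factor -1 through the depth, or turned
  into a plus sign, giving e_0; together this is e_0 - e_1. The overall sign is the depth 1 of the
  fully merged index.\<close>

lemma coarsenings_sum:
  "k \<noteq> [] \<Longrightarrow> index k \<Longrightarrow>
    (\<Sum>l\<leftarrow>coarsenings k. (-1) ^ dep l * F (gaps l)) = - pairing F (map star_letter (gaps k))"
proof (induction k arbitrary: F rule: coarsenings.induct)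
  case (2 k)
  then show ?case
    using pairing_E0_replicate[of F "k - 1" "[]"] by (simp add: dep_def star_letter_def)
next
  case (3 k1 k2 ks)
  have pos: "0 < k1" "0 < k2" "index (k2 # ks)" "index ((k1 + k2) # ks)"
    using 3(4) by (auto simp: index_def)
  let ?F = "\<lambda>w. F (replicate (k1 - 1) False @ True # w)"
  let ?x = "map star_letter (gaps (k2 # ks))"
  have "(\<Sum>l\<leftarrow>coarsenings (k2 # ks). (-1) ^ dep (k1 # l) * F (gaps (k1 # l))) =
      (\<Sum>l\<leftarrow>coarsenings (k2 # ks). - ((-1) ^ dep l * ?F (gaps l)))"
    using coarsenings_index[of "k2 # ks"] pos
    by (intro arg_cong[where f = sum_list] map_cong refl) (simp add: gaps_Cons dep_def)
  also have "\<dots> = pairing ?F ?x"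
    using 3(1)[of ?F] pos(3) by (simp add: uminus_sum_list_map[unfolded o_def, symmetric])
  finally have 1: "(\<Sum>l\<leftarrow>coarsenings (k2 # ks). (-1) ^ dep (k1 # l) * F (gaps (k1 # l))) =
      pairing F (replicate (k1 - 1) E0 @ E1 # ?x)"
    by (simp add: pairing_E0_replicate)
  have "gaps ((k1 + k2) # ks) = replicate (k1 - 1) False @ False # gaps (k2 # ks)"
  proof -
    have "replicate (k1 + k2 - 1) False = replicate (k1 - 1) False @ False # replicate (k2 - 1) False"
      using pos(1,2) by (simp flip: replicate_Suc replicate_add)
    then show ?thesis
      by (cases ks) auto
  qed
  then have 2: "(\<Sum>l\<leftarrow>coarsenings ((k1 + k2) # ks). (-1) ^ dep l * F (gaps l)) =
      - pairing F (replicate (k1 - 1) E0 @ E0 # ?x)"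
    using 3(2)[of F] pos(4) by (simp add: star_letter_def[of False])
  have "(\<Sum>l\<leftarrow>coarsenings (k1 # k2 # ks). (-1) ^ dep l * F (gaps l)) =
      - pairing F (replicate (k1 - 1) E0 @ Ediff # ?x)"
    using 1 2 pairing_split[of F "replicate (k1 - 1) E0" ?x] by (simp add: o_def)
  then show ?case
    by (simp add: star_letter_def[of True] star_letter_def[of False])
qed simp

section \<open>The KZ equation\<close>

text \<open>The plane without [1, \<infinity>). It contains 0, where the regular factor of the KZ
  solution has to be holomorphic; the second cut along the nonpositive reals is caused by the
  logarithm alone.\<close>

definition slit_plane :: "complex set" where
  "slit_plane = {z. Im z \<noteq> 0 \<or> Re z < 1}"

definition doubly_slit_plane :: "complex set" where
  "doubly_slit_plane = {z. Im z \<noteq> 0 \<or> 0 < Re z \<and> Re z < 1}"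

lemma open_slit_plane: "open slit_plane"
  unfolding slit_plane_def
  by (intro open_Collect_disj open_Collect_neq open_Collect_less continuous_intros)

lemma open_doubly_slit_plane: "open doubly_slit_plane"
  unfolding doubly_slit_plane_def
  by (intro open_Collect_disj open_Collect_conj open_Collect_neq open_Collect_less continuous_intros)

lemma zero_in_slit_plane: "0 \<in> slit_plane"
  by (simp add: slit_plane_def)

lemma half_in_doubly_slit_plane: "1 / 2 \<in> doubly_slit_plane"
  by (simp add: doubly_slit_plane_def)

lemma one_notin_slit_plane: "1 \<notin> slit_plane"
  by (simp add: slit_plane_def)

lemma doubly_slit_planeD:
  assumes "z \<in> doubly_slit_plane"
  shows "z \<in> slit_plane" "1 - z \<in> slit_plane" "1 - z \<in> doubly_slit_plane" "z \<noteq> 0" "z \<noteq> 1"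
    "z \<notin> \<real>\<^sub>\<le>\<^sub>0"
  using assms by (auto simp: doubly_slit_plane_def slit_plane_def complex_nonpos_Reals_iff)

lemma starlike_slit_plane: "starlike slit_plane"
  unfolding starlike_def
proof (intro bexI ballI subsetI)
  fix z w assume z: "z \<in> slit_plane" and "w \<in> closed_segment 0 z"
  then obtain u where u: "0 \<le> u" "u \<le> 1" "w = of_real u * z"
    by (auto simp: in_segment scaleR_conv_of_real)
  show "w \<in> slit_plane"
  proof (cases "u = 0 \<or> Im z \<noteq> 0")
    case False
    then have "Re z < 1" "0 < u"
      using z u by (auto simp: slit_plane_def)
    then have "u * Re z < u"
      by simp
    then show ?thesis
      using u by (simp add: slit_plane_def)
  qed (use u in \<open>auto simp: slit_plane_def\<close>)
qed (rule zero_in_slit_plane)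

lemma starlike_doubly_slit_plane: "starlike doubly_slit_plane"
  unfolding starlike_def
proof (intro bexI ballI subsetI)
  fix z w assume z: "z \<in> doubly_slit_plane" and "w \<in> closed_segment (1 / 2) z"
  then obtain u where u: "0 \<le> u" "u \<le> 1" "w = of_real (1 - u) * (1 / 2) + of_real u * z"
    by (auto simp: in_segment scaleR_conv_of_real)
  have *: "Re w = (1 - u) / 2 + u * Re z" "Im w = u * Im z"
    by (simp_all add: u(3))
  show "w \<in> doubly_slit_plane"
  proof (cases "u = 0 \<or> Im z \<noteq> 0")
    case False
    then have "0 < Re z" "Re z < 1" "0 < u"
      using z u by (auto simp: doubly_slit_plane_def)
    then have "0 < u * Re z" "u * Re z < u"
      by simp_all
    then show ?thesis
      using u(1,2) unfolding doubly_slit_plane_def mem_Collect_eq * by (auto simp: field_simps)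
  qed (use * in \<open>auto simp: doubly_slit_plane_def\<close>)
qed (rule half_in_doubly_slit_plane)

lemma connected_doubly_slit_plane: "connected doubly_slit_plane"
  by (intro starlike_imp_connected starlike_doubly_slit_plane)

text \<open>The derivative is prescribed only away from 0, because the integrands N z / z have a
  removable singularity there and division by 0 returns 0 instead of the limit. Holomorphy of f
  covers the point 0.\<close>

definition is_primitive :: "(complex \<Rightarrow> complex) \<Rightarrow> (complex \<Rightarrow> complex) \<Rightarrow> bool" where
  "is_primitive g f \<longleftrightarrow> f holomorphic_on slit_plane \<and> f 0 = 0 \<and>
    (\<forall>z\<in>slit_plane - {0}. (f has_field_derivative g z) (at z))"

lemma primitive_exists:
  assumes N: "N holomorphic_on slit_plane" and "N 0 = 0"
  shows "\<exists>f. is_primitive (\<lambda>z. N z / z) f"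
proof -
  define g where "g z = (if z = 0 then deriv N 0 else (N z - N 0) / (z - 0))" for z
  have "g holomorphic_on slit_plane"
    unfolding g_def using zero_in_slit_plane open_slit_plane
    by (intro pole_lemma N) (simp add: interior_open)
  then have "\<exists>f. \<forall>z\<in>slit_plane. (f has_field_derivative g z) (at z)"
    by (intro holomorphic_starlike_primitive[where k = "{}"] holomorphic_on_imp_continuous_on
        starlike_slit_plane open_slit_plane)
      (auto intro: holomorphic_on_imp_differentiable_at open_slit_plane)
  then obtain f where f: "\<And>z. z \<in> slit_plane \<Longrightarrow> (f has_field_derivative g z) (at z)"
    by blast
  have deriv: "((\<lambda>z. f z - f 0) has_field_derivative g z) (at z)" if "z \<in> slit_plane" for z
    using f[OF that] by (auto intro!: derivative_eq_intros)
  have "((\<lambda>z. f z - f 0) has_field_derivative N z / z) (at z)" if "z \<in> slit_plane - {0}" for z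
    using deriv[of z] that assms(2) by (simp add: g_def)
  moreover have "(\<lambda>z. f z - f 0) holomorphic_on slit_plane"
    unfolding holomorphic_on_open[OF open_slit_plane] using deriv by blast
  ultimately have "is_primitive (\<lambda>z. N z / z) (\<lambda>z. f z - f 0)"
    by (simp add: is_primitive_def)
  then show ?thesis
    by (rule exI[of _ "\<lambda>z. f z - f 0"])
qed

text \<open>The coefficients of the solution \<open>h(z) z\<^bsup>X\<^sub>0\<^esup>\<close> of the KZ equation, without the factor
  \<open>z\<^bsup>X\<^sub>0\<^esup>\<close>. They satisfy \<open>z h' = X\<^sub>0 h - h X\<^sub>0 + z / (z - 1) X\<^sub>1 h\<close>, hence are single-valued near 0.\<close>

function hpl :: "word \<Rightarrow> complex \<Rightarrow> complex" where
  "hpl w = (if w = [] then (\<lambda>_. 1) else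
    (SOME f. is_primitive (\<lambda>z. ((if hd w then z / (z - 1) else 1) * hpl (tl w) z
      - (if last w then 0 else hpl (butlast w) z)) / z) f))"
  by auto
termination
  by (relation "Wellfounded.measure length") auto

declare hpl.simps [simp del]

lemma hpl_Nil [simp]: "hpl [] = (\<lambda>_. 1)"
  by (simp add: hpl.simps)

lemma hpl_aux:
  "hpl w holomorphic_on slit_plane \<and> hpl w 0 = nc_one w \<and>
    (w \<noteq> [] \<longrightarrow> is_primitive (\<lambda>z. ((if hd w then z / (z - 1) else 1) * hpl (tl w) z
      - (if last w then 0 else hpl (butlast w) z)) / z) (hpl w))"
proof (induction w rule: length_induct)
  case (1 w)
  show ?case
  proof (cases "w = []")
    case False
    let ?N = "\<lambda>z. (if hd w then z / (z - 1) else 1) * hpl (tl w) z - (if last w then 0 else hpl (butlast w) z)"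
    have IH: "hpl (tl w) holomorphic_on slit_plane" "hpl (butlast w) holomorphic_on slit_plane"
      "hpl (tl w) 0 = nc_one (tl w)" "hpl (butlast w) 0 = nc_one (butlast w)"
      using 1 False by simp_all
    have "?N holomorphic_on slit_plane"
      using one_notin_slit_plane by (cases "hd w"; cases "last w") (auto intro!: holomorphic_intros IH)
    \<comment> \<open>For the word X_0 the contributions of X_0 h and h X_0 cancel, for X_1 the
      factor z / (z - 1) vanishes, and for longer words both neighbours are normalised to 0 at 0. So
      no logarithm arises.\<close>
    moreover have "?N 0 = 0"
    proof (cases "tl w = []")
      case True
      then have "w = [hd w]"
        using False by (metis list.collapse)
      then have "butlast w = []" "last w = hd w"
        by (metis butlast.simps(2), metis last.simps)
      then show ?thesis
        using True by (cases "hd w") simp_all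
    next
      case False
      then have "butlast w \<noteq> []"
        by (cases w) simp_all
      then show ?thesis
        using False by (simp add: IH(3,4) nc_one_def)
    qed
    ultimately have "\<exists>f. is_primitive (\<lambda>z. ?N z / z) f"
      by (rule primitive_exists)
    then have "is_primitive (\<lambda>z. ?N z / z) (SOME f. is_primitive (\<lambda>z. ?N z / z) f)"
      by (rule someI_ex)
    moreover have "hpl w = (SOME f. is_primitive (\<lambda>z. ?N z / z) f)"
      by (subst hpl.simps) (simp only: False if_False)
    ultimately have "is_primitive (\<lambda>z. ?N z / z) (hpl w)"
      by simp
    then show ?thesis
      using False by (simp add: is_primitive_def nc_one_def)
  qed (simp add: nc_one_def)
qed

lemma holomorphic_hpl: "hpl w holomorphic_on slit_plane"
  using hpl_aux[of w] by (rule conjunct1)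

lemma hpl_0: "hpl w 0 = nc_one w"
  using hpl_aux[of w] by (elim conjE)

definition Hser :: "complex \<Rightarrow> word \<Rightarrow> complex" where
  "Hser z w = hpl w z"

lemma Hser_Nil [simp]: "Hser z [] = 1"
  by (simp add: Hser_def)

lemma Hser_0: "Hser 0 = nc_one"
  by (simp add: Hser_def hpl_0 fun_eq_iff)

lemma Hser_differentiable: "z \<in> slit_plane \<Longrightarrow> (\<lambda>z. Hser z w) field_differentiable (at z)"
  unfolding Hser_def
  by (rule holomorphic_on_imp_differentiable_at[OF holomorphic_hpl open_slit_plane])

lemma Hser_deriv:
  assumes "z \<in> slit_plane" "z \<noteq> 0"
  shows "((\<lambda>z. Hser z w) has_field_derivative
    ((letter False \<odot> Hser z) w - (Hser z \<odot> letter False) w) / z + (letter True \<odot> Hser z) w / (z - 1)) (at z)"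
proof (cases "w = []")
  case True
  then show ?thesis
    by simp
next
  case False
  let ?D = "((if hd w then z / (z - 1) else 1) * hpl (tl w) z - (if last w then 0 else hpl (butlast w) z)) / z"
  have "((\<lambda>z. Hser z w) has_field_derivative ?D) (at z)"
    using hpl_aux[of w] assms False by (simp add: is_primitive_def Hser_def[abs_def])
  moreover have "(letter a \<odot> Hser z) w = (if a = hd w then hpl (tl w) z else 0)" for a
    using False by (cases w) (auto simp: letter_mult_Cons Hser_def)
  moreover have "(Hser z \<odot> letter False) w = (if last w then 0 else hpl (butlast w) z)"
    using False by (cases w rule: rev_cases) (auto simp: mult_letter_snoc Hser_def)
  moreover have "?D = ((if hd w then 0 else hpl (tl w) z) - (if last w then 0 else hpl (butlast w) z)) / z
      + (if hd w then hpl (tl w) z else 0) / (z - 1)"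
    using assms(2) by (cases "hd w") (simp_all add: diff_divide_distrib)
  ultimately show ?thesis
    by (cases "hd w") simp_all
qed

section \<open>Solutions of the KZ equation and their connection matrix\<close>

lemma nc_mult_deriv:
  assumes "\<And>v. ((\<lambda>z. F z v) has_field_derivative F' v) (at x)"
    and "\<And>v. ((\<lambda>z. G z v) has_field_derivative G' v) (at x)"
  shows "((\<lambda>z. (F z \<odot> G z) w) has_field_derivative (F' \<odot> G x) w + (F x \<odot> G') w) (at x)"
  unfolding nc_mult_def sum.distrib[symmetric]
  by (intro DERIV_sum) (auto intro!: derivative_eq_intros assms)

lemma nc_mult_differentiable:
  assumes "\<And>v. (\<lambda>z. F z v) field_differentiable at x" and "\<And>v. (\<lambda>z. G z v) field_differentiable at x"
  shows "(\<lambda>z. (F z \<odot> G z) w) field_differentiable at x"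
  unfolding nc_mult_def
  by (intro field_differentiable_sum field_differentiable_mult assms)

lemma nc_mult_isCont:
  fixes F G :: "complex \<Rightarrow> word \<Rightarrow> complex"
  assumes "\<And>v. isCont (\<lambda>z. F z v) x" and "\<And>v. isCont (\<lambda>z. G z v) x"
  shows "isCont (\<lambda>z. (F z \<odot> G z) w) x"
  unfolding nc_mult_def by (intro continuous_intros assms)

lemma nc_exp_deriv:
  assumes "(g has_field_derivative g') (at x)"
  shows "((\<lambda>z. nc_exp (g z) b w) has_field_derivative g' * (letter b \<odot> nc_exp (g x) b) w) (at x)"
proof (cases "w = replicate (length w) b")
  case True
  then obtain n where n: "w = replicate n b"
    by metis
  show ?thesis
  proof (cases n)
    case 0
    then show ?thesis
      by (simp add: n)
  next
    case (Suc m)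
    have "(1 + of_nat m :: complex) \<noteq> 0"
      by (metis of_nat_Suc of_nat_neq_0)
    moreover have "fact (Suc m) = (1 + of_nat m :: complex) * fact m"
      by simp
    ultimately have "(1 + of_nat m) * (g' * g x ^ m) / fact (Suc m) = g' * (g x ^ m / fact m)"
      by (simp only: nonzero_mult_divide_mult_cancel_left fact_nonzero times_divide_eq_right not_False_eq_True)
    with DERIV_cdivide[OF DERIV_power_Suc[OF assms, of m], of "fact (Suc m)"]
    have "((\<lambda>z. g z ^ Suc m / fact (Suc m)) has_field_derivative g' * (g x ^ m / fact m)) (at x)"
      by simp
    moreover have "(letter b \<odot> nc_exp (g x) b) w = g x ^ m / fact m"
      by (simp add: n Suc letter_mult_Cons nc_exp_replicate)
    moreover have "nc_exp (g z) b w = g z ^ Suc m / fact (Suc m)" for z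
      by (simp only: n Suc nc_exp_replicate)
    ultimately show ?thesis
      by simp
  qed
next
  case False
  then have "nc_exp c b w = 0" for c
    by (rule nc_exp_eq_0)
  moreover have "(letter b \<odot> nc_exp (g x) b) w = 0"
  proof (cases w)
    case (Cons a v)
    then show ?thesis
      using False by (auto simp: letter_mult_Cons intro!: nc_exp_eq_0)
  qed simp
  ultimately show ?thesis
    by simp
qed

lemma nc_exp_isCont: "isCont g x \<Longrightarrow> isCont (\<lambda>z. nc_exp (g z) b w) x"
  unfolding nc_exp_def by (cases "w = replicate (length w) b") (auto intro!: continuous_intros)

definition kz_sol :: "complex set \<Rightarrow> (complex \<Rightarrow> word \<Rightarrow> complex) \<Rightarrow> bool" where
  "kz_sol U X \<longleftrightarrow> (\<forall>z\<in>U. \<forall>w. ((\<lambda>z. X z w) has_field_derivative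
    (letter False \<odot> X z) w / z + (letter True \<odot> X z) w / (z - 1)) (at z))"

lemma kz_solD:
  "kz_sol U X \<Longrightarrow> z \<in> U \<Longrightarrow> ((\<lambda>z. X z w) has_field_derivative
    (letter False \<odot> X z) w / z + (letter True \<odot> X z) w / (z - 1)) (at z)"
  by (simp add: kz_sol_def)

lemma kz_sol_subset: "kz_sol U X \<Longrightarrow> V \<subseteq> U \<Longrightarrow> kz_sol V X"
  by (auto simp: kz_sol_def)

text \<open>The derivative of a coefficient involves only the word with its first letter removed. By
  induction the difference of two solutions has derivative 0 at every word, hence is constant on the
  connected set.\<close>

lemma kz_sol_unique:
  assumes U: "open U" "connected U" and X: "kz_sol U X" and Y: "kz_sol U Y"
    and z0: "z0 \<in> U" "X z0 = Y z0" and "z \<in> U"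
  shows "X z = Y z"
proof
  fix w
  show "X z w = Y z w"
    using \<open>z \<in> U\<close>
  proof (induction w arbitrary: z)
    have *: "X z w = Y z w"
      if "z \<in> U" "\<And>z a. z \<in> U \<Longrightarrow> (letter a \<odot> X z) w = (letter a \<odot> Y z) w" for z w
    proof -
      have d: "((\<lambda>z. X z w - Y z w) has_field_derivative 0) (at z)" if "z \<in> U" for z
        using DERIV_diff[OF kz_solD[OF X that, of w] kz_solD[OF Y that, of w]]
          \<open>\<And>z a. z \<in> U \<Longrightarrow> (letter a \<odot> X z) w = (letter a \<odot> Y z) w\<close>[OF that] by simp
      then have "continuous_on U (\<lambda>z. X z w - Y z w)"
        by (meson DERIV_isCont continuous_at_imp_continuous_on)
      then obtain c where "\<And>z. z \<in> U \<Longrightarrow> X z w - Y z w = c"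
        using DERIV_zero_connected_constant[of U "{}" "\<lambda>z. X z w - Y z w"] U d by auto
      from this[of z] this[of z0] show ?thesis
        using z0 that by simp
    qed
    {
      case Nil
      then show ?case
        by (intro *) simp_all
    next
      case (Cons a w)
      then show ?case
        by (intro *) (simp_all add: letter_mult_Cons)
    }
  qed
qed

lemma kz_sol_mult_const:
  assumes "kz_sol U X"
  shows "kz_sol U (\<lambda>z. X z \<odot> C)"
  unfolding kz_sol_def
proof (intro ballI allI)
  fix z w assume "z \<in> U"
  have "((\<lambda>z. (X z \<odot> C) w) has_field_derivative
      ((\<lambda>v. (letter False \<odot> X z) v / z + (letter True \<odot> X z) v / (z - 1)) \<odot> C) w + (X z \<odot> (\<lambda>_. 0)) w) (at z)"
    by (intro nc_mult_deriv kz_solD[OF assms] DERIV_const \<open>z \<in> U\<close>)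
  then show "((\<lambda>z. (X z \<odot> C) w) has_field_derivative
      (letter False \<odot> (X z \<odot> C)) w / z + (letter True \<odot> (X z \<odot> C)) w / (z - 1)) (at z)"
    using nc_mult_scale_left[of "1 / z" "letter False \<odot> X z" C w]
      nc_mult_scale_left[of "1 / (z - 1)" "letter True \<odot> X z" C w]
      nc_mult_scale_right[of "X z" 0 "\<lambda>_. 0" w]
    by (simp add: nc_mult_add_left nc_mult_assoc)
qed

text \<open>The generating series of multiple polylogarithms: the solution that behaves like exp(X_0
  Ln z) at 0.\<close>

definition Lser :: "complex \<Rightarrow> word \<Rightarrow> complex" where
  "Lser z = Hser z \<odot> nc_exp (Ln z) False"

lemma Lser_Nil [simp]: "Lser z [] = 1"
  by (simp add: Lser_def)

lemma kz_sol_Lser: "kz_sol doubly_slit_plane Lser"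
  unfolding kz_sol_def
proof (intro ballI allI)
  fix z w assume z: "z \<in> doubly_slit_plane"
  note z' = doubly_slit_planeD[OF z]
  let ?E = "nc_exp (Ln z) False"
  let ?A = "\<lambda>v. (letter False \<odot> Hser z) v" and ?B = "\<lambda>v. (Hser z \<odot> letter False) v"
    and ?C = "\<lambda>v. (letter True \<odot> Hser z) v"
  have Ln: "(Ln has_field_derivative 1 / z) (at z)"
    using z'(6) by (auto intro!: derivative_eq_intros simp: divide_inverse)
  have "((\<lambda>z. Lser z w) has_field_derivative
      ((\<lambda>v. (?A v - ?B v) / z + ?C v / (z - 1)) \<odot> ?E) w
      + (Hser z \<odot> (\<lambda>v. 1 / z * (letter False \<odot> ?E) v)) w) (at z)"
    unfolding Lser_def
    by (intro nc_mult_deriv Hser_deriv nc_exp_deriv Ln z')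
  also have "(\<lambda>v. (?A v - ?B v) / z + ?C v / (z - 1)) =
      (\<lambda>v. 1 / z * (?A v - ?B v) + 1 / (z - 1) * ?C v)"
    by simp
  also have "((\<lambda>v. 1 / z * (?A v - ?B v) + 1 / (z - 1) * ?C v) \<odot> ?E) w
      + (Hser z \<odot> (\<lambda>v. 1 / z * (letter False \<odot> ?E) v)) w =
      (letter False \<odot> Lser z) w / z + (letter True \<odot> Lser z) w / (z - 1)"
    by (simp only: nc_mult_add_left nc_mult_scale_left nc_mult_scale_right nc_mult_diff_left)
      (simp add: nc_mult_assoc Lser_def algebra_simps)
  finally show "((\<lambda>z. Lser z w) has_field_derivative
      (letter False \<odot> Lser z) w / z + (letter True \<odot> Lser z) w / (z - 1)) (at z)" .
qed

lemma swap_letter: "swap (letter a) = letter (\<not> a)"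
  by (auto simp: swap_def letter_def fun_eq_iff map_eq_Cons_conv)

text \<open>Under z \<mapsto> 1 - z the forms dz / z and dz / (z - 1) are exchanged, and exchanging
  X_0 and X_1 restores the equation. This is the solution normalised at 1.\<close>

lemma kz_sol_swap: "kz_sol doubly_slit_plane (\<lambda>z. swap (Lser (1 - z)))"
  unfolding kz_sol_def
proof (intro ballI allI)
  fix z w assume "z \<in> doubly_slit_plane"
  then have z: "1 - z \<in> doubly_slit_plane" "z \<noteq> 0" "z \<noteq> 1"
    using doubly_slit_planeD by blast+
  let ?w = "map Not w"
  have 1: "(letter a \<odot> Lser (1 - z)) ?w = (letter (\<not> a) \<odot> swap (Lser (1 - z))) w" for a
    using swap_mult[of "letter a" "Lser (1 - z)"] by (metis swap_def swap_letter)
  have deriv: "((\<lambda>z. Lser (1 - z) ?w) has_field_derivative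
     ((letter False \<odot> Lser (1 - z)) ?w / (1 - z) + (letter True \<odot> Lser (1 - z)) ?w / (1 - z - 1)) * (- 1)) (at z)"
    by (rule DERIV_chain2[where f = "\<lambda>z. Lser z ?w" and g = "\<lambda>z. 1 - z", OF kz_solD[OF kz_sol_Lser z(1)]]) (auto intro!: derivative_eq_intros)
  have eq: "(p / (1 - z) + q / (1 - z - 1)) * (- 1) = q / z + p / (z - 1)" for p q
  proof -
    have "p / (1 - z) = - (p / (z - 1))"
      by (metis minus_diff_eq minus_divide_right)
    moreover have "1 - z - 1 = - z"
      by simp
    ultimately show ?thesis
      by simp
  qed
  show "((\<lambda>z. swap (Lser (1 - z)) w) has_field_derivative
      (letter False \<odot> swap (Lser (1 - z))) w / z + (letter True \<odot> swap (Lser (1 - z))) w / (z - 1)) (at z)"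
    using deriv unfolding eq 1 by (simp add: swap_def[of _ w])
qed

text \<open>The constant relating the solutions normalised at 0 and at 1. It may be read off at any
  point; 1/2 is chosen because it is fixed by z \<mapsto> 1 - z. That it agrees with
  \<open>PhiKZ\<close> is proved later.\<close>

definition Phi :: "word \<Rightarrow> complex" where
  "Phi = nc_solve (swap (Lser (1 / 2))) (Lser (1 / 2))"

lemma swap_Lser_Nil [simp]: "swap (Lser z) [] = 1"
  by (simp add: swap_def)

lemma Lser_half: "swap (Lser (1 / 2)) \<odot> Phi = Lser (1 / 2)"
  unfolding Phi_def by (rule nc_mult_solve) simp

lemma Lser_connection:
  assumes "z \<in> doubly_slit_plane"
  shows "Lser z = swap (Lser (1 - z)) \<odot> Phi"
  by (rule kz_sol_unique[OF open_doubly_slit_plane connected_doubly_slit_plane kz_sol_Lser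
        kz_sol_mult_const[OF kz_sol_swap] half_in_doubly_slit_plane _ assms])
    (simp add: Lser_half)

text \<open>At the fixed point 1/2 the connection relation and its swapped form involve the same two
  series and undo each other.\<close>

lemma swap_Phi_mult: "swap Phi \<odot> Phi = nc_one"
proof -
  let ?L = "Lser (1 / 2)"
  have "swap ?L \<odot> (Phi \<odot> swap Phi) = ?L \<odot> swap Phi"
    by (simp add: Lser_half flip: nc_mult_assoc)
  also have "\<dots> = swap (swap ?L \<odot> Phi)"
    by (simp only: swap_mult swap_swap)
  also have "\<dots> = swap ?L \<odot> nc_one"
    by (simp add: Lser_half)
  finally have "Phi \<odot> swap Phi = nc_one"
    by (rule nc_mult_left_cancel[rotated]) simp
  from arg_cong[where f = swap, OF this] show ?thesis
    by (simp add: swap_mult)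
qed

section \<open>Asymptotics at the singular point 0 and shuffle relations\<close>

lemma tendsto_times_Ln_power: "((\<lambda>z. z * Ln z ^ k) \<longlongrightarrow> 0) (at 0)"
proof -
  have 1: "filterlim (\<lambda>r. pi - ln r) at_top (at_right (0::real))"
    by real_asymp
  \<comment> \<open>With x = pi - ln r, which equals pi + |ln r| for r < 1, one has r = exp pi / exp
    x, so it remains that exp dominates powers.\<close>
  have "((\<lambda>r. exp pi * ((pi - ln r) ^ k / exp (pi - ln r))) \<longlongrightarrow> exp pi * 0) (at_right 0)"
    by (intro tendsto_mult tendsto_const filterlim_compose[OF tendsto_power_div_exp_0 1])
  moreover have "\<forall>\<^sub>F r in at_right (0::real). r \<in> {0<..<1}"
    by (rule eventually_at_right_real) simp
  then have "\<forall>\<^sub>F r in at_right 0. exp pi * ((pi - ln r) ^ k / exp (pi - ln r)) = r * (\<bar>ln r\<bar> + pi) ^ k"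
    by eventually_elim (simp add: exp_diff abs_if)
  ultimately have "((\<lambda>r. r * (\<bar>ln r\<bar> + pi) ^ k) \<longlongrightarrow> 0) (at_right 0)"
    by (simp add: tendsto_cong)
  moreover have "filterlim cmod (at_right 0) (at 0)"
    by (intro filterlim_at_withinI tendsto_norm_zero tendsto_ident_at)
      (auto simp: eventually_at_filter)
  ultimately have "((\<lambda>z. cmod z * (\<bar>ln (cmod z)\<bar> + pi) ^ k) \<longlongrightarrow> 0) (at 0)"
    by (rule filterlim_compose)
  moreover have "\<forall>\<^sub>F z in at 0. norm (z * Ln z ^ k) \<le> cmod z * (\<bar>ln (cmod z)\<bar> + pi) ^ k"
  proof (rule eventually_at_filter[THEN iffD2], intro always_eventually allI impI)
    fix z :: complex assume z: "z \<noteq> 0"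
    have "cmod (Ln z) \<le> \<bar>Re (Ln z)\<bar> + \<bar>Im (Ln z)\<bar>"
      by (rule cmod_le)
    also have "\<dots> \<le> \<bar>ln (cmod z)\<bar> + pi"
      using z Im_Ln_le_pi[OF z] mpi_less_Im_Ln[OF z] by simp
    finally have "cmod (Ln z) ^ k \<le> (\<bar>ln (cmod z)\<bar> + pi) ^ k"
      by (rule power_mono) simp
    then show "norm (z * Ln z ^ k) \<le> cmod z * (\<bar>ln (cmod z)\<bar> + pi) ^ k"
      by (simp add: norm_mult norm_power mult_left_mono)
  qed
  ultimately show ?thesis
    by (rule Lim_null_comparison[rotated])
qed

lemma tendsto_differentiable_times_Ln_power:
  assumes "f field_differentiable (at 0)" "f 0 = 0"
  shows "((\<lambda>z. f z * Ln z ^ k) \<longlongrightarrow> 0) (at 0)"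
proof -
  obtain f' where "(f has_field_derivative f') (at 0)"
    using assms by (auto simp: field_differentiable_def)
  then have "((\<lambda>z. f z / z) \<longlongrightarrow> f') (at 0)"
    using assms(2) by (simp add: has_field_derivative_iff)
  from tendsto_mult[OF this tendsto_times_Ln_power[of k]]
  have "((\<lambda>z. f z / z * (z * Ln z ^ k)) \<longlongrightarrow> 0) (at 0)"
    by simp
  then show ?thesis
    by (rule Lim_transform_eventually) (auto simp: eventually_at_filter)
qed

text \<open>A differentiable factor vanishing at 0 is O(z) and beats every power of the logarithm.
  The additional power of Ln z serves products with further coefficients of exp(X_0 Ln z).\<close>

lemma tendsto_nc_mult_exp_Ln:
  assumes "\<And>v. (\<lambda>z. K z v) field_differentiable (at 0)" "\<And>v. K 0 v = 0"
  shows "((\<lambda>z. (K z \<odot> nc_exp (Ln z) b) w * Ln z ^ k) \<longlongrightarrow> 0) (at 0)"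
  unfolding nc_mult_def sum_distrib_right
proof (rule tendsto_null_sum)
  fix i
  show "((\<lambda>z. K z (take i w) * nc_exp (Ln z) b (drop i w) * Ln z ^ k) \<longlongrightarrow> 0) (at 0)"
  proof (cases "drop i w = replicate (length (drop i w)) b")
    case True
    then obtain n where n: "drop i w = replicate n b"
      by metis
    have "((\<lambda>z. K z (take i w) * Ln z ^ (n + k) / fact n) \<longlongrightarrow> 0 / fact n) (at 0)"
      by (intro tendsto_divide tendsto_differentiable_times_Ln_power assms tendsto_const) simp
    then show ?thesis
      by (simp add: n nc_exp_replicate power_add mult_ac)
  next
    case False
    then show ?thesis
      using nc_exp_eq_0[OF False] by simp
  qed
qed

lemma islimpt_ray:
  fixes a e :: complex
  assumes "e \<noteq> 0" "\<And>r. 0 < r \<Longrightarrow> a + of_real r * e \<in> U"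
  shows "a islimpt U"
  unfolding islimpt_approachable
proof (intro allI impI)
  fix \<epsilon> :: real assume "0 < \<epsilon>"
  let ?r = "\<epsilon> / (2 * cmod e)"
  have "0 < ?r"
    using assms(1) \<open>0 < \<epsilon>\<close> by simp
  moreover have "dist (a + of_real ?r * e) a = \<epsilon> / 2"
    using assms(1) \<open>0 < \<epsilon>\<close> by (simp add: dist_norm norm_mult norm_divide)
  ultimately show "\<exists>x'\<in>U. x' \<noteq> a \<and> dist x' a < \<epsilon>"
    using assms(1) \<open>0 < \<epsilon>\<close> by (intro bexI[of _ "a + of_real ?r * e"] conjI assms(2)) auto
qed

text \<open>Uniqueness with initial condition at the singular point 0, which is only a limit point
  of U. The constant G = Y^-1 X is 1: once the shorter coefficients are known, G w = X z w - Y z w,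
  and this tends to 0 since P - Q vanishes at 0.\<close>

lemma kz_sol_unique_at_0:
  assumes U: "open U" "connected U" "U \<noteq> {}" "0 islimpt U" and X: "kz_sol U X" and Y: "kz_sol U Y"
    and XP: "\<And>z. z \<in> U \<Longrightarrow> X z = P z \<odot> nc_exp (Ln z) False"
    and YQ: "\<And>z. z \<in> U \<Longrightarrow> Y z = Q z \<odot> nc_exp (Ln z) False"
    and P: "\<And>v. (\<lambda>z. P z v) field_differentiable (at 0)" "P 0 = nc_one" "\<And>z. P z [] = 1"
    and Q: "\<And>v. (\<lambda>z. Q z v) field_differentiable (at 0)" "Q 0 = nc_one" "\<And>z. Q z [] = 1"
    and "z \<in> U"
  shows "X z = Y z"
proof -
  obtain z0 where z0: "z0 \<in> U"
    using U(3) by blast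
  define G where "G = nc_solve (Y z0) (X z0)"
  have Nil: "X z [] = 1" "Y z [] = 1" if "z \<in> U" for z
    using that by (simp_all add: XP YQ P(3) Q(3))
  have XYG: "X z = Y z \<odot> G" if "z \<in> U" for z
    by (rule kz_sol_unique[OF U(1,2) X kz_sol_mult_const[OF Y] z0 _ that])
      (simp add: G_def nc_mult_solve Nil[OF z0])
  have "G w = nc_one w" for w
  proof (induction w rule: length_induct)
    case (1 w)
    show ?case
    proof (cases "w = []")
      case True
      then show ?thesis
        using fun_cong[OF XYG[OF z0], of "[]"] Nil[OF z0] by (simp add: nc_one_def)
    next
      case False
      have G: "X z w - Y z w = G w" if "z \<in> U" for z
      proof -
        have "Y z (take i w) * G (drop i w) = (if i = length w then Y z w else 0)"
          if "i \<in> {1..length w}" for i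
          using that False 1 by (cases "i = length w") (auto simp: nc_one_def)
        then have "(\<Sum>i=1..length w. Y z (take i w) * G (drop i w)) = Y z w"
          using False by (simp add: Suc_le_eq)
        then show ?thesis
          using XYG[OF that] Nil[OF that] by (simp add: nc_mult_single_left[of "Y z" G])
      qed
      have "((\<lambda>z. ((\<lambda>v. P z v - Q z v) \<odot> nc_exp (Ln z) False) w * Ln z ^ 0) \<longlongrightarrow> 0) (at 0)"
        by (intro tendsto_nc_mult_exp_Ln field_differentiable_diff P(1) Q(1)) (simp add: P(2) Q(2))
      then have "((\<lambda>z. ((\<lambda>v. P z v - Q z v) \<odot> nc_exp (Ln z) False) w * Ln z ^ 0) \<longlongrightarrow> 0) (at 0 within U)"
        by (rule tendsto_within_subset) simp
      moreover have "\<forall>\<^sub>F z in at 0 within U.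
          ((\<lambda>v. P z v - Q z v) \<odot> nc_exp (Ln z) False) w * Ln z ^ 0 = G w"
        unfolding eventually_at_filter
        by (intro always_eventually allI impI) (simp add: nc_mult_diff_left G[symmetric] XP YQ)
      ultimately have "((\<lambda>z. G w) \<longlongrightarrow> 0) (at 0 within U)"
        by (rule Lim_transform_eventually)
      then have "G w = 0"
        using U(4) by (simp add: tendsto_const_iff trivial_limit_within)
      then show ?thesis
        using False by (simp add: nc_one_def)
    qed
  qed
  then have "G = nc_one" ..
  then show ?thesis
    using XYG[OF \<open>z \<in> U\<close>] by simp
qed

lemma DERIV_sum_list:
  assumes "\<And>w. w \<in> set ws \<Longrightarrow> ((\<lambda>z. f z w) has_field_derivative f' w) (at x)"
  shows "((\<lambda>z. \<Sum>w\<leftarrow>ws. f z w) has_field_derivative (\<Sum>w\<leftarrow>ws. f' w)) (at x)"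
  using assms by (induction ws) (auto intro!: derivative_eq_intros)

lemma sh_deriv:
  assumes "\<And>w. ((\<lambda>z. F z w) has_field_derivative F' w) (at x)"
  shows "((\<lambda>z. sh (F z) u v) has_field_derivative sh F' u v) (at x)"
  unfolding sh_def using assms by (intro DERIV_sum_list)

lemma tendsto_sh_0:
  fixes F :: "complex \<Rightarrow> word \<Rightarrow> complex"
  assumes "\<And>w. ((\<lambda>z. F z w) \<longlongrightarrow> 0) A"
  shows "((\<lambda>z. sh (F z) u v) \<longlongrightarrow> 0) A"
proof -
  have "((\<lambda>z. \<Sum>w\<leftarrow>ws. F z w) \<longlongrightarrow> 0) A" for ws
    using assms by (induction ws) (auto intro!: tendsto_add_zero)
  then show ?thesis
    by (simp add: sh_def)
qed

lemma islimpt_doubly_slit_plane: "0 islimpt doubly_slit_plane"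
  by (rule islimpt_ray[of \<i>]) (auto simp: doubly_slit_plane_def)

text \<open>By the KZ equation the defect of the shuffle relation is constant, and it tends to 0 at 0
  because \<open>z\<^bsup>X\<^sub>0\<^esup>\<close> satisfies the shuffle relations.\<close>

lemma nc_char_Lser:
  assumes "z \<in> doubly_slit_plane"
  shows "nc_char (Lser z)"
proof -
  let ?D = "\<lambda>u v z. Lser z u * Lser z v - sh (Lser z) u v"
  have D: "?D u v z = 0" if "z \<in> doubly_slit_plane" for u v z
    using that
  proof (induction u v arbitrary: z rule: shuffle.induct)
    case (3 a u b v)
    have deriv: "(?D (a # u) (b # v) has_field_derivative 0) (at z)" if z: "z \<in> doubly_slit_plane" for z
    proof -
      let ?o = "\<lambda>c. if c then 1 / (z - 1) else 1 / z"
      have d: "((\<lambda>z. Lser z (c # w)) has_field_derivative ?o c * Lser z w) (at z)" for c w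
        using kz_solD[OF kz_sol_Lser z, of "c # w"] by (cases c) (simp_all add: letter_mult_Cons)
      have "((\<lambda>z. Lser z (a # u) * Lser z (b # v)
            - (sh (\<lambda>w. Lser z (a # w)) u (b # v) + sh (\<lambda>w. Lser z (b # w)) (a # u) v))
          has_field_derivative (?o a * Lser z u * Lser z (b # v) + ?o b * Lser z v * Lser z (a # u))
            - (sh (\<lambda>w. ?o a * Lser z w) u (b # v) + sh (\<lambda>w. ?o b * Lser z w) (a # u) v)) (at z)"
        by (intro DERIV_diff DERIV_add DERIV_mult sh_deriv d)
      moreover have "(?o a * Lser z u * Lser z (b # v) + ?o b * Lser z v * Lser z (a # u))
            - (sh (\<lambda>w. ?o a * Lser z w) u (b # v) + sh (\<lambda>w. ?o b * Lser z w) (a # u) v)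
          = ?o a * ?D u (b # v) z + ?o b * ?D (a # u) v z"
        unfolding sh_scale by (simp add: ring_distribs mult_ac)
      ultimately show ?thesis
        using 3(1)[OF z] 3(2)[OF z] by (simp add: sh_Cons[of _ a])
    qed
    then have "continuous_on doubly_slit_plane (?D (a # u) (b # v))"
      by (meson DERIV_isCont continuous_at_imp_continuous_on)
    then obtain c where c: "\<And>z. z \<in> doubly_slit_plane \<Longrightarrow> ?D (a # u) (b # v) z = c"
      using DERIV_zero_connected_constant[of doubly_slit_plane "{}" "?D (a # u) (b # v)"]
        open_doubly_slit_plane connected_doubly_slit_plane deriv by auto
    let ?E = "\<lambda>z. nc_exp (Ln z) False"
    \<comment> \<open>As exp(X_0 Ln z) satisfies the shuffle relations, the defect comes from r
      alone. Its mixed terms multiply r by unbounded powers of Ln z, so r must tend to 0 even after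
      such a multiplication.\<close>
    define r where "r z = (\<lambda>w. Hser z w - nc_one w) \<odot> ?E z" for z
    have L: "Lser z w = ?E z w + r z w" for z w
      by (simp add: r_def nc_mult_diff_left Lser_def)
    have r: "((\<lambda>z. r z w * Ln z ^ k) \<longlongrightarrow> 0) (at 0)" for w k
      unfolding r_def
      by (intro tendsto_nc_mult_exp_Ln field_differentiable_diff Hser_differentiable
          zero_in_slit_plane field_differentiable_const) (simp add: Hser_0)
    have rE: "((\<lambda>z. r z w * ?E z w') \<longlongrightarrow> 0) (at 0)" for w w'
    proof (cases "w' = replicate (length w') False")
      case True
      then obtain n where n: "w' = replicate n False"
        by metis
      from tendsto_divide[OF r[of w n] tendsto_const[of "fact n"]] show ?thesis
        by (simp add: n nc_exp_replicate)
    next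
      case False
      then show ?thesis
        using nc_exp_eq_0[OF False] by simp
    qed
    have r0: "((\<lambda>z. r z w) \<longlongrightarrow> 0) (at 0)" for w
      using r[of w 0] by simp
    have "((\<lambda>z. r z (a # u) * ?E z (b # v) + r z (b # v) * ?E z (a # u) + r z (a # u) * r z (b # v)
        - sh (r z) (a # u) (b # v)) \<longlongrightarrow> 0 + 0 + 0 * 0 - 0) (at 0)"
      by (intro tendsto_diff tendsto_add rE tendsto_mult r0 tendsto_sh_0)
    moreover have "r z (a # u) * ?E z (b # v) + r z (b # v) * ?E z (a # u) + r z (a # u) * r z (b # v)
        - sh (r z) (a # u) (b # v) = ?D (a # u) (b # v) z" for z
    proof -
      have "Lser z = (\<lambda>w. ?E z w + r z w)"
        by (rule ext) (rule L)
      then have "sh (Lser z) (a # u) (b # v) = ?E z (a # u) * ?E z (b # v) + sh (r z) (a # u) (b # v)"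
        by (simp only: sh_add nc_charD(2)[OF nc_char_exp])
      then show ?thesis
        by (simp add: L algebra_simps)
    qed
    ultimately have "(?D (a # u) (b # v) \<longlongrightarrow> 0) (at 0)"
      by simp
    then have "(?D (a # u) (b # v) \<longlongrightarrow> 0) (at 0 within doubly_slit_plane)"
      by (rule tendsto_within_subset) simp
    moreover have "\<forall>\<^sub>F z in at 0 within doubly_slit_plane. ?D (a # u) (b # v) z = c"
      unfolding eventually_at_filter using c by (intro always_eventually) blast
    ultimately have "((\<lambda>z. c) \<longlongrightarrow> 0) (at 0 within doubly_slit_plane)"
      by (rule Lim_transform_eventually)
    then have "c = 0"
      using islimpt_doubly_slit_plane by (simp add: tendsto_const_iff trivial_limit_within)
    then show ?case
      using c[OF 3(3)] by simp
  qed simp_all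
  then show ?thesis
    using assms by (simp add: nc_char_def)
qed

lemma nc_char_Phi: "nc_char Phi"
  by (rule nc_char_cancel[of "swap (Lser (1 / 2))"])
    (simp_all add: nc_char_swap nc_char_Lser Lser_half half_in_doubly_slit_plane)

section \<open>Expansion at 0 and multiple zeta values\<close>

text \<open>The terms of \<open>zeta_rev\<close> whose largest summation variable is n, with the
  empty sum placed at n = 0. Up to sign these are the Taylor coefficients of a multiple
  polylogarithm.\<close>

definition zeta_coeff :: "nat list \<Rightarrow> nat \<Rightarrow> real" where
  "zeta_coeff ks n = (case ks of [] \<Rightarrow> if n = 0 then 1 else 0
    | k # ks' \<Rightarrow> if n = 0 then 0 else 1 / real n ^ k * zeta_rev ks' (n - 1))"

lemma zeta_rev_eq_sum: "zeta_rev ks N = (\<Sum>n\<le>N. zeta_coeff ks n)"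
proof (cases ks)
  case Nil
  then show ?thesis
    by (simp add: zeta_coeff_def)
next
  case (Cons k ks')
  have "(\<Sum>n\<le>N. zeta_coeff ks n) = (\<Sum>n=1..N. zeta_coeff ks n)"
    by (intro sum.mono_neutral_right) (auto simp: zeta_coeff_def Cons)
  then show ?thesis
    by (simp add: Cons zeta_coeff_def)
qed

lemma zeta_rev_nonneg: "0 \<le> zeta_rev ks N"
  by (induction ks N rule: zeta_rev.induct) (auto intro!: sum_nonneg)

lemma zeta_coeff_nonneg: "0 \<le> zeta_coeff ks n"
  by (auto simp: zeta_coeff_def zeta_rev_nonneg split: list.split)

definition hpl_fps :: "word \<Rightarrow> complex fps" where
  "hpl_fps w = fps_expansion (hpl w) 0"

lemma has_fps_expansion_hpl: "hpl w has_fps_expansion hpl_fps w"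
  unfolding hpl_fps_def
  by (rule has_fps_expansion_fps_expansion[OF open_slit_plane zero_in_slit_plane holomorphic_hpl])

lemma hpl_fps_0: "fps_nth (hpl_fps w) 0 = nc_one w"
  by (simp add: hpl_fps_def fps_expansion_def hpl_0)

lemma hpl_fps_sums:
  assumes "norm z < 1"
  shows "(\<lambda>n. fps_nth (hpl_fps w) n * z ^ n) sums hpl w z"
proof -
  have "ball 0 1 \<subseteq> slit_plane"
  proof
    fix z :: complex assume "z \<in> ball 0 1"
    then show "z \<in> slit_plane"
      using complex_Re_le_cmod[of z] by (simp add: slit_plane_def)
  qed
  then have "hpl w holomorphic_on ball 0 1"
    using holomorphic_hpl holomorphic_on_subset by blast
  from holomorphic_power_series[OF this, of z] assms show ?thesis
    by (simp add: hpl_fps_def fps_expansion_def)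
qed

text \<open>For words ending in X_1 the term h X_0 contributes nothing, and h obeys the plain
  recursion of iterated integrals.\<close>

lemma hpl_deriv:
  assumes "last (a # v)" "z \<in> slit_plane" "z \<noteq> 0"
  shows "deriv (hpl (a # v)) z = hpl v z / (if a then z - 1 else z)"
proof -
  have "a # v = butlast (a # v) @ [True]"
    using assms(1) by (metis append_butlast_last_id list.distinct(1))
  then have "(Hser z \<odot> letter False) (a # v) = 0"
    using mult_letter_snoc[of "Hser z" False "butlast (a # v)" True] by simp
  then have "((\<lambda>z. Hser z (a # v)) has_field_derivative hpl v z / (if a then z - 1 else z)) (at z)"
    using Hser_deriv[OF assms(2,3), of "a # v"] by (cases a) (simp_all add: letter_mult_Cons Hser_def[of z v])
  then show ?thesis
    by (simp add: Hser_def DERIV_imp_deriv)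
qed

lemma eventually_slit_plane: "\<forall>\<^sub>F z in nhds 0. z \<in> slit_plane"
  using open_slit_plane zero_in_slit_plane by (rule eventually_nhds_in_open)

lemma has_fps_expansion_eqI:
  fixes f g :: "complex \<Rightarrow> complex"
  assumes "f has_fps_expansion F" "g has_fps_expansion G" "\<And>z. z \<in> slit_plane \<Longrightarrow> f z = g z"
  shows "F = G"
proof -
  have "\<forall>\<^sub>F z in nhds 0. f z = g z"
    using eventually_slit_plane by eventually_elim (rule assms(3))
  then have "g has_fps_expansion F"
    using assms(1) by (simp cong: has_fps_expansion_cong)
  then show ?thesis
    using assms(2) fps_expansion_unique_complex by metis
qed

lemma hpl_fps_False:
  assumes "last (False # v)"
  shows "fps_X * fps_deriv (hpl_fps (False # v)) = hpl_fps v"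
proof (rule has_fps_expansion_eqI)
  show "(\<lambda>z. z * deriv (hpl (False # v)) z) has_fps_expansion fps_X * fps_deriv (hpl_fps (False # v))"
    by (intro fps_expansion_intros has_fps_expansion_hpl)
  show "hpl v has_fps_expansion hpl_fps v"
    by (rule has_fps_expansion_hpl)
  fix z assume "z \<in> slit_plane"
  then show "z * deriv (hpl (False # v)) z = hpl v z"
    using hpl_deriv[OF assms, of z] assms
    by (cases "z = 0") (auto simp: hpl_0 nc_one_def split: if_splits)
qed

lemma hpl_fps_True:
  assumes "last (True # v)"
  shows "(fps_X - 1) * fps_deriv (hpl_fps (True # v)) = hpl_fps v"
proof -
  \<comment> \<open>The differential equation is known away from 0; the extra factor z makes both
    sides agree at 0 too and is cancelled afterwards.\<close>
  have "fps_X * ((fps_X - 1) * fps_deriv (hpl_fps (True # v))) = fps_X * hpl_fps v"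
  proof (rule has_fps_expansion_eqI)
    show "(\<lambda>z. z * ((z - 1) * deriv (hpl (True # v)) z)) has_fps_expansion
        fps_X * ((fps_X - 1) * fps_deriv (hpl_fps (True # v)))"
      by (intro fps_expansion_intros has_fps_expansion_hpl)
    show "(\<lambda>z. z * hpl v z) has_fps_expansion fps_X * hpl_fps v"
      by (intro fps_expansion_intros has_fps_expansion_hpl)
    fix z assume "z \<in> slit_plane"
    then show "z * ((z - 1) * deriv (hpl (True # v)) z) = z * hpl v z"
      using hpl_deriv[OF assms, of z] one_notin_slit_plane by (cases "z = 0"; cases "z = 1") auto
  qed
  then show ?thesis
    by simp
qed

lemma rev_ek_Cons: "rev (ek (rev (k # ks))) = replicate (k - 1) False @ True # rev (ek (rev ks))"
  by (simp add: ek_append)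

lemma last_rev_ek: "last (True # rev (ek (rev ks)))"
proof (cases "ks = []")
  case False
  then have "last (rev (ek (rev ks))) = True"
    by (simp add: last_rev ek_eq)
  then show ?thesis
    by simp
qed simp

text \<open>\<open>ks\<close> starts with the outermost summation. A letter X_0 divides the n-th
  coefficient by n; a letter X_1 multiplies the series by 1 / (z - 1), which forms negated partial
  sums, and integrates. This builds the nested sum from the inside.\<close>

lemma hpl_fps_nth:
  "index ks \<Longrightarrow> fps_nth (hpl_fps (rev (ek (rev ks)))) n = of_real ((-1) ^ length ks * zeta_coeff ks n)"
proof (induction ks arbitrary: n)
  case Nil
  have "hpl_fps [] = 1"
    using has_fps_expansion_hpl[of "[]"] by (intro has_fps_expansion_eqI[of "\<lambda>_. 1" _ "\<lambda>_. 1"]) (simp_all add: has_fps_expansion_1)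
  then show ?case
    by (simp add: zeta_coeff_def)
next
  case (Cons k ks)
  let ?w = "rev (ek (rev ks))"
  have IH: "fps_nth (hpl_fps ?w) n = of_real ((-1) ^ length ks * zeta_coeff ks n)" for n
    using Cons by (simp add: index_def)
  have *: "fps_nth (hpl_fps (replicate j False @ True # ?w)) (Suc n) =
      of_real ((-1) ^ Suc (length ks) * (zeta_rev ks n / real (Suc n) ^ Suc j))" for j n
  proof (induction j arbitrary: n)
    case 0
    let ?F = "hpl_fps (True # ?w)"
    have rec: "of_nat (Suc n) * fps_nth ?F (Suc n) = of_nat n * fps_nth ?F n - fps_nth (hpl_fps ?w) n" for n
    proof -
      have "fps_nth ((fps_X - 1) * fps_deriv ?F) n = fps_nth (hpl_fps ?w) n"
        by (simp only: hpl_fps_True[OF last_rev_ek])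
      then have "of_nat n * fps_nth ?F n - of_nat (Suc n) * fps_nth ?F (Suc n) = fps_nth (hpl_fps ?w) n"
        by (cases n) (simp_all add: left_diff_distrib)
      moreover have "y = x - z" if "x - y = z" for x y z :: complex
        using that by auto
      ultimately show ?thesis
        by blast
    qed
    have "of_nat (Suc n) * fps_nth ?F (Suc n) = of_real ((-1) ^ Suc (length ks) * zeta_rev ks n)"
    proof (induction n)
      case 0
      show ?case
        unfolding rec by (simp add: IH zeta_rev_eq_sum)
    next
      case (Suc n)
      show ?case
        unfolding rec[of "Suc n"] Suc by (simp add: IH zeta_rev_eq_sum algebra_simps)
    qed
    then have "fps_nth ?F (Suc n) = of_real ((-1) ^ Suc (length ks) * zeta_rev ks n) / of_nat (Suc n)"
      by (simp add: field_simps del: of_nat_Suc)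
    then show ?case
      by simp
  next
    case (Suc j)
    let ?v = "replicate j False @ True # ?w"
    have "last (False # ?v)"
      using last_rev_ek[of ks] by simp
    from arg_cong[where f = "\<lambda>F. fps_nth F (Suc n)", OF hpl_fps_False[OF this]]
    have "of_nat (Suc n) * fps_nth (hpl_fps (False # ?v)) (Suc n) = fps_nth (hpl_fps ?v) (Suc n)"
      by simp
    then have "fps_nth (hpl_fps (False # ?v)) (Suc n) = fps_nth (hpl_fps ?v) (Suc n) / of_nat (Suc n)"
      by (simp add: field_simps del: of_nat_Suc)
    then show ?case
      by (simp add: Suc field_simps del: of_nat_Suc)
  qed
  have "0 < k"
    using Cons.prems by (simp add: index_def)
  show ?case
  proof (cases n)
    case 0
    then show ?thesis
      by (simp add: rev_ek_Cons hpl_fps_0 zeta_coeff_def nc_one_def del: rev.simps)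
  next
    case (Suc m)
    show ?thesis
      unfolding Suc rev_ek_Cons * using \<open>0 < k\<close> by (simp add: zeta_coeff_def)
  qed
qed

text \<open>The Tauberian converse of Abel's theorem for nonnegative coefficients: partial sums are
  bounded by the limit, which gives convergence. In this way the convergence of the multiple zeta
  series is derived from the KZ solution.\<close>

lemma sums_if_power_series_tendsto:
  fixes a :: "nat \<Rightarrow> real"
  assumes a: "\<And>n. 0 \<le> a n" and g: "\<And>x. 0 < x \<Longrightarrow> x < 1 \<Longrightarrow> (\<lambda>n. a n * x ^ n) sums g x"
    and lim: "(g \<longlongrightarrow> c) (at_left 1)"
  shows "a sums c"
proof -
  have ev: "\<forall>\<^sub>F x in at_left (1::real). x \<in> {0<..<1}"
    by (rule eventually_at_left_real) simp
  have partial: "(\<Sum>n<N. a n) \<le> c" for N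
  proof (rule tendsto_le[OF _ lim])
    show "((\<lambda>x. \<Sum>n<N. a n * x ^ n) \<longlongrightarrow> (\<Sum>n<N. a n)) (at_left 1)"
      by (auto intro!: tendsto_eq_intros)
    show "\<forall>\<^sub>F x in at_left 1. (\<Sum>n<N. a n * x ^ n) \<le> g x"
      using ev
    proof eventually_elim
      case (elim x)
      then have "(\<lambda>n. a n * x ^ n) sums g x"
        by (intro g) auto
      moreover from elim have "\<And>n. 0 \<le> a n * x ^ n"
        using a by simp
      ultimately have "(\<Sum>n<N. a n * x ^ n) \<le> (\<Sum>n. a n * x ^ n)"
        by (intro sum_le_suminf) (auto dest: sums_summable)
      then show ?case
        by (simp only: sums_unique[OF \<open>(\<lambda>n. a n * x ^ n) sums g x\<close>, symmetric])
    qed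
  qed simp
  have "(\<Sum>n\<le>N. a n) \<le> c" for N
    using partial[of "Suc N"] by (simp only: lessThan_Suc_atMost)
  then have "summable a"
    by (intro bounded_imp_summable[of a c] a)
  moreover have "suminf a \<le> c"
    by (rule suminf_le_const[OF \<open>summable a\<close>]) (rule partial)
  moreover have "c \<le> suminf a"
  proof (rule tendsto_upperbound[OF lim])
    show "\<forall>\<^sub>F x in at_left 1. g x \<le> suminf a"
      using ev
    proof eventually_elim
      case (elim x)
      then have g': "(\<lambda>n. a n * x ^ n) sums g x"
        by (intro g) auto
      have "a n * x ^ n \<le> a n" for n
        using elim a by (intro mult_left_le power_le_one) auto
      then have "(\<Sum>n. a n * x ^ n) \<le> suminf a"
        by (rule suminf_le[OF _ sums_summable[OF g'] \<open>summable a\<close>])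
      then show ?case
        by (simp only: sums_unique[OF g', symmetric])
    qed
  qed simp
  ultimately show ?thesis
    using summable_sums[of a] by simp
qed

section \<open>Boundary values at 1: identification of \<open>Phi\<close> with
  \<open>PhiKZ\<close>\<close>

lemma Lser_last:
  assumes "last w" "w \<noteq> []"
  shows "Lser z w = hpl w z"
proof -
  have w: "w = butlast w @ [True]"
    using assms by (metis append_butlast_last_id)
  \<comment> \<open>Every nonempty suffix still ends in X_1, so the logarithmic factor contributes
    only its constant term.\<close>
  have "nc_exp (Ln z) False (drop i w) = 0" if "i < length w" for i
  proof (rule nc_exp_eq_0')
    have "last (drop i w) = True"
      using that assms by simp
    then show "(\<not> False) \<in> set (drop i w)"
      using that by (metis last_in_set drop_eq_Nil leD not_False_eq_True)
  qed
  then show ?thesis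
    by (simp add: Lser_def nc_mult_single_right Hser_def)
qed

lemma swap_Lser: "swap (Lser z) = swap (Hser z) \<odot> nc_exp (Ln z) True"
  by (simp add: Lser_def swap_mult)

text \<open>By the connection relation Lser (1 - z) is a regular factor tending to 1, times exp(X_1
  Ln z), times \<open>Phi\<close>. At a word beginning with X_0 the exponential contributes only its
  constant term, so the divergent powers of Ln z disappear.\<close>

lemma Lser_tendsto_Phi:
  "((\<lambda>z. Lser (1 - z) (False # v)) \<longlongrightarrow> Phi (False # v)) (at 0 within doubly_slit_plane)"
proof -
  let ?K = "\<lambda>z v. swap (Hser z) v - nc_one v" and ?E = "\<lambda>z. nc_exp (Ln z) True"
  have K: "((\<lambda>z. (?K z \<odot> ?E z) w) \<longlongrightarrow> 0) (at 0)" for w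
  proof -
    have "((\<lambda>z. (?K z \<odot> ?E z) w * Ln z ^ 0) \<longlongrightarrow> 0) (at 0)"
    proof (intro tendsto_nc_mult_exp_Ln field_differentiable_diff field_differentiable_const)
      show "(\<lambda>z. swap (Hser z) w) field_differentiable at 0" for w
        unfolding swap_def by (rule Hser_differentiable[OF zero_in_slit_plane])
      show "swap (Hser 0) w - nc_one w = 0" for w
        by (simp add: Hser_0)
    qed
    then show ?thesis
      by simp
  qed
  have "((\<lambda>z. (?K z \<odot> ?E z \<odot> Phi) (False # v)) \<longlongrightarrow> 0) (at 0 within doubly_slit_plane)"
    unfolding nc_mult_def[of "nc_mult A B" Phi for A B]
    by (intro tendsto_null_sum tendsto_mult_left_zero tendsto_within_subset[OF K]) simp
  from tendsto_add[OF this tendsto_const[of "Phi (False # v)"]]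
  have "((\<lambda>z. (?K z \<odot> ?E z \<odot> Phi) (False # v) + Phi (False # v)) \<longlongrightarrow> Phi (False # v)) (at 0 within doubly_slit_plane)"
    by simp
  moreover have "\<forall>\<^sub>F z in at 0 within doubly_slit_plane.
      (?K z \<odot> ?E z \<odot> Phi) (False # v) + Phi (False # v) = Lser (1 - z) (False # v)"
    unfolding eventually_at_filter
  proof (intro always_eventually allI impI)
    fix z assume "z \<in> doubly_slit_plane"
    then have "Lser (1 - z) = swap (Hser z) \<odot> ?E z \<odot> Phi"
      using Lser_connection[of "1 - z"] doubly_slit_planeD(3)[of z] by (simp add: swap_Lser)
    moreover have "(\<lambda>v. nc_exp (Ln z) True (False # v)) = (\<lambda>_. 0)"
      by (rule ext) (simp add: nc_exp_eq_0')
    then have "(?E z \<odot> Phi) (False # v) = Phi (False # v)"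
      by (simp add: nc_mult_Cons nc_mult_zero_left)
    ultimately show "(?K z \<odot> ?E z \<odot> Phi) (False # v) + Phi (False # v) = Lser (1 - z) (False # v)"
      by (simp add: nc_mult_assoc nc_mult_diff_left)
  qed
  ultimately show ?thesis
    by (rule Lim_transform_eventually)
qed

lemma Lser_tendsto_Phi_real:
  "((\<lambda>x. Lser (of_real x) (False # v)) \<longlongrightarrow> Phi (False # v)) (at_left 1)"
proof -
  have "\<forall>\<^sub>F x in at_left (1::real). x \<in> {0<..<1}"
    by (rule eventually_at_left_real) simp
  then have "\<forall>\<^sub>F x in at_left 1. complex_of_real (1 - x) \<in> doubly_slit_plane - {0}"
    by eventually_elim (auto simp: doubly_slit_plane_def)
  moreover have "((\<lambda>x. complex_of_real (1 - x)) \<longlongrightarrow> 0) (at_left 1)"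
    by (auto intro!: tendsto_eq_intros)
  ultimately have "filterlim (\<lambda>x. complex_of_real (1 - x)) (at 0 within doubly_slit_plane) (at_left 1)"
    by (auto simp: filterlim_at elim: eventually_mono)
  from filterlim_compose[OF Lser_tendsto_Phi this] show ?thesis
    by simp
qed

lemma Phi_rev_ek:
  assumes "admissible k" "k \<noteq> []"
  shows "Phi (rev (ek k)) = of_real ((-1) ^ dep k * mzv k)"
proof -
  let ?w = "rev (ek k)" and ?ks = "rev k" and ?s = "(-1) ^ dep k :: real"
  have ks: "index ?ks" "rev ?ks = k" "length ?ks = dep k" and last: "2 \<le> last k"
    using assms by (auto simp: admissible_def index_def dep_def)
  have w_last: "last ?w" "?w \<noteq> []"
    using assms(2) by (simp_all add: ek_eq last_rev)
  have "k = butlast k @ [last k]"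
    using assms(2) by simp
  then have "ek k = ek (butlast k) @ True # replicate (last k - 1) False"
    using ek_append[of "butlast k" "[last k]"] by simp
  \<comment> \<open>Admissibility enters here: the last entry is at least 2, so the reversed word
    begins with X_0, as the limit at 1 demands.\<close>
  moreover have "last k - 1 = Suc (last k - 2)"
    using last by simp
  ultimately have "?w = False # replicate (last k - 2) False @ True # rev (ek (butlast k))"
    by (simp add: replicate_append_same)
  then obtain v where v: "?w = False # v"
    by blast
  have sums: "(\<lambda>n. complex_of_real (?s * zeta_coeff ?ks n * x ^ n)) sums hpl ?w (of_real x)"
    if "0 < x" "x < 1" for x
    using hpl_fps_sums[of "of_real x" ?w] hpl_fps_nth[OF ks(1)] that by (simp add: ks dep_def)
  define g where "g x = ?s * Re (hpl ?w (of_real x))" for x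
  have g: "(\<lambda>n. zeta_coeff ?ks n * x ^ n) sums g x" and im: "Im (hpl ?w (of_real x)) = 0"
    if "0 < x" "x < 1" for x
  proof -
    from sums_Re[OF sums[OF that]] have "(\<lambda>n. ?s * zeta_coeff ?ks n * x ^ n) sums Re (hpl ?w (of_real x))"
      by simp
    from sums_mult[OF this, of ?s] show "(\<lambda>n. zeta_coeff ?ks n * x ^ n) sums g x"
      by (simp add: g_def mult.assoc[symmetric] power_add[symmetric])
    from sums_Im[OF sums[OF that]] show "Im (hpl ?w (of_real x)) = 0"
      by (simp add: sums_iff)
  qed
  have lim: "((\<lambda>x. hpl ?w (of_real x)) \<longlongrightarrow> Phi ?w) (at_left 1)"
    using Lser_tendsto_Phi_real[of v] Lser_last[OF w_last] by (simp add: v)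
  have g_lim: "(g \<longlongrightarrow> ?s * Re (Phi ?w)) (at_left 1)"
    unfolding g_def by (intro tendsto_mult tendsto_const tendsto_Re lim)
  have "zeta_coeff ?ks sums (?s * Re (Phi ?w))"
    by (rule sums_if_power_series_tendsto[OF _ _ g_lim]) (simp_all add: zeta_coeff_nonneg g)
  then have "zeta_rev ?ks \<longlonglongrightarrow> ?s * Re (Phi ?w)"
    by (simp add: sums_def_le zeta_rev_eq_sum[abs_def])
  then have "mzv k = ?s * Re (Phi ?w)"
    by (simp add: mzv_def limI)
  then have "?s * mzv k = Re (Phi ?w)"
    by (simp add: mult.assoc[symmetric] power_add[symmetric])
  moreover have "Im (Phi ?w) = 0"
  proof -
    have "\<forall>\<^sub>F x in at_left (1::real). x \<in> {0<..<1}"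
      by (rule eventually_at_left_real) simp
    then have "\<forall>\<^sub>F x in at_left 1. Im (hpl ?w (of_real x)) = 0"
      by eventually_elim (simp add: im)
    with tendsto_Im[OF lim] have "((\<lambda>x. 0) \<longlongrightarrow> Im (Phi ?w)) (at_left (1::real))"
      by (rule Lim_transform_eventually)
    then show ?thesis
      by (simp add: tendsto_const_iff)
  qed
  ultimately show ?thesis
    by (simp add: complex_eq_iff)
qed

lemma hpl_False:
  assumes "z \<in> slit_plane"
  shows "hpl [False] z = 0"
proof -
  have "((\<lambda>z. hpl [False] z) has_field_derivative 0) (at z)" if "z \<in> slit_plane - {0}" for z
    using Hser_deriv[of z "[False]"] mult_letter_snoc[of "Hser z" False "[]" False] that
    by (simp add: letter_mult_Cons Hser_def)
  then obtain c where "\<And>z. z \<in> slit_plane \<Longrightarrow> hpl [False] z = c"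
    using DERIV_zero_connected_constant[of slit_plane "{0}" "hpl [False]"] open_slit_plane
      starlike_imp_connected[OF starlike_slit_plane] holomorphic_on_imp_continuous_on[OF holomorphic_hpl]
    by auto
  from this[OF assms] this[OF zero_in_slit_plane] show ?thesis
    by (simp add: hpl_0 nc_one_def)
qed

text \<open>For X_0 the solution is Ln z, which tends to 0 at 1; X_1 then follows from
  \<open>swap_Phi_mult\<close> in degree one.\<close>

lemma Phi_letter: "Phi [a] = 0"
proof -
  have "((\<lambda>x. Lser (of_real x) [False]) \<longlongrightarrow> Phi [False]) (at_left 1)"
    by (rule Lser_tendsto_Phi_real)
  moreover have "\<forall>\<^sub>F x in at_left (1::real). x \<in> {0<..<1}"
    by (rule eventually_at_left_real) simp
  then have "\<forall>\<^sub>F x in at_left 1. Lser (of_real x) [False] = Ln (complex_of_real x)"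
  proof eventually_elim
    case (elim x)
    then have "hpl [False] (of_real x) = 0"
      by (intro hpl_False) (simp add: slit_plane_def)
    then show ?case
      using nc_exp_replicate[of "Ln (of_real x)" False 1]
      by (simp add: Lser_def nc_mult_Cons nc_mult_def Hser_def)
  qed
  ultimately have "((\<lambda>x. Ln (complex_of_real x)) \<longlongrightarrow> Phi [False]) (at_left 1)"
    by (rule Lim_transform_eventually)
  moreover have "((\<lambda>x. Ln (complex_of_real x)) \<longlongrightarrow> Ln (of_real 1)) (at_left 1)"
    by (intro tendsto_intros) simp
  ultimately have "Phi [False] = 0"
    using tendsto_unique[of "at_left (1::real)"] by force
  moreover have "Phi [False] + Phi [True] = 0"
    using fun_cong[OF swap_Phi_mult, of "[True]"] nc_charD(1)[OF nc_char_Phi]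
    by (simp add: nc_mult_Cons nc_mult_def nc_one_def swap_def add.commute)
  ultimately show ?thesis
    by (cases a) simp_all
qed

text \<open>The coefficients of \<open>Phi\<close> on reversed words meet the conditions
  characterising \<open>Zsh\<close>. As \<open>Zsh\<close> is real valued, their imaginary part is
  first shown to vanish, by the same uniqueness principle.\<close>

lemma PhiKZ_eq: "PhiKZ = Phi"
proof -
  let ?F = "\<lambda>w. Phi (rev w)"
  have F: "?F u * ?F v = sh ?F u v" for u v
    using nc_charD(2)[OF nc_char_Phi] by (simp add: sh_rev)
  have Im: "Im (?F w) = 0" for w
  proof (rule regularisation_unique[of "\<lambda>w. Im (?F w)"])
    fix a v
    have "(\<Sum>i\<le>length v. ?F (take i v @ a # drop i v)) = ?F [a] * ?F v"
      unfolding F sh_single ..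
    then show "(\<Sum>i\<le>length v. Im (?F (take i v @ a # drop i v))) = 0"
      by (simp only: Im_sum[symmetric]) (simp add: Phi_letter)
  next
    fix u
    obtain k where "k \<noteq> []" "admissible k" "ek k = True # u @ [False]"
      by (rule admissible_ek)
    then show "Im (?F (True # u @ [False])) = 0"
      using Phi_rev_ek[of k] by simp
  qed (simp add: nc_charD(1)[OF nc_char_Phi])
  have "Zsh = (\<lambda>w. Re (?F w))"
  proof (rule Zsh_eqI)
    have "Re (?F u) * Re (?F v) = sh (\<lambda>w. Re (?F w)) u v" for u v
    proof -
      have "Re (?F u) * Re (?F v) = Re (sh ?F u v)"
        by (simp add: Im flip: F)
      also have "\<dots> = sh (\<lambda>w. Re (?F w)) u v"
      proof -
        have "Re (\<Sum>w\<leftarrow>ws. ?F w) = (\<Sum>w\<leftarrow>ws. Re (?F w))" for ws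
          by (induction ws) auto
        then show ?thesis
          by (simp add: sh_def)
      qed
      finally show ?thesis .
    qed
    then show "shuffle_hom (\<lambda>w. Re (?F w))"
      by (simp add: shuffle_hom_def sh_def nc_charD(1)[OF nc_char_Phi])
  qed (simp_all add: Phi_rev_ek Phi_letter)
  then show ?thesis
    using Im[of "rev w" for w] by (simp add: PhiKZ_def fun_eq_iff complex_eq_iff)
qed

section \<open>Monodromy\<close>

lemma pairing_deriv:
  assumes "\<And>v. ((\<lambda>z. F z v) has_field_derivative F' v) (at x)"
  shows "((\<lambda>z. pairing (F z) u) has_field_derivative pairing F' u) (at x)"
  using assms
proof (induction u arbitrary: F F')
  case (Cons pq u)
  obtain p q where pq: "pq = (p, q)"
    by force
  show ?case
    unfolding pq pairing.simps
    by (rule Cons.IH) (auto intro!: derivative_eq_intros Cons.prems)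
qed simp

lemma pairing_isCont:
  fixes F :: "complex \<Rightarrow> word \<Rightarrow> complex"
  assumes "\<And>v. isCont (\<lambda>z. F z v) x"
  shows "isCont (\<lambda>z. pairing (F z) u) x"
  using assms
proof (induction u arbitrary: F)
  case (Cons pq u)
  obtain p q where pq: "pq = (p, q)"
    by force
  show ?case
    unfolding pq pairing.simps
    by (rule Cons.IH) (intro continuous_intros Cons.prems)
qed simp

lemma sub_inf_differentiable:
  assumes "\<And>v. (\<lambda>z. F z v) field_differentiable at x"
  shows "(\<lambda>z. sub_inf (F z) w) field_differentiable at x"
  unfolding sub_inf_def field_differentiable_def
  by (rule exI, rule pairing_deriv, rule field_differentiable_derivI[OF assms])

lemma sub_inf_one [simp]: "sub_inf nc_one = nc_one"
  by (rule sub_inf_id) (auto simp: nc_one_def)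

lemma sub_inf_letter_False [simp]: "sub_inf (letter False) = letter False"
  by (rule sub_inf_id) (auto simp: letter_def)

lemma sub_inf_letter_True: "sub_inf (letter True) w = - letter False w - letter True w"
proof (cases w)
  case (Cons a v)
  then show ?thesis
    using sub_inf_scale[of "-1" nc_one v] letter_Cons[of True] letter_Cons[of False]
    by (cases a) (simp_all add: fun_eq_iff)
qed simp

text \<open>For \<zeta> = z / (z - 1) one has d\<zeta> / \<zeta> = dz / z - dz / (z - 1) and
  d\<zeta> / (\<zeta> - 1) = - dz / (z - 1). Replacing X_1 by - X_0 - X_1 makes the terms X_0 dz /
  (z - 1) cancel and restores the KZ form.\<close>

lemma kz_sol_sub_inf:
  assumes X: "kz_sol V X" and UV: "\<And>z. z \<in> U \<Longrightarrow> z \<noteq> 0 \<and> z \<noteq> 1 \<and> z / (z - 1) \<in> V"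
  shows "kz_sol U (\<lambda>z. sub_inf (X (z / (z - 1))))"
  unfolding kz_sol_def
proof (intro ballI allI)
  fix z w assume "z \<in> U"
  define \<zeta> where "\<zeta> = z / (z - 1)"
  have z: "z \<noteq> 0" "z \<noteq> 1" "\<zeta> \<in> V"
    using UV[OF \<open>z \<in> U\<close>] by (simp_all add: \<zeta>_def)
  define d where "d = - 1 / (z - 1)\<^sup>2"
  let ?A = "letter False \<odot> X \<zeta>" and ?B = "letter True \<odot> X \<zeta>" and ?S = "sub_inf (X \<zeta>)"
  have "((\<lambda>z. z / (z - 1)) has_field_derivative d) (at z)"
    using z by (auto intro!: derivative_eq_intros simp: d_def power2_eq_square divide_simps)
  then have "((\<lambda>z. X (z / (z - 1)) v) has_field_derivative (?A v / \<zeta> + ?B v / (\<zeta> - 1)) * d) (at z)" for v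
    using kz_solD[OF X z(3), of v] unfolding \<zeta>_def
    by (intro DERIV_chain2[where f = "\<lambda>z. X z v" and g = "\<lambda>z. z / (z - 1)"])
  then have "((\<lambda>z. sub_inf (X (z / (z - 1))) w) has_field_derivative
      sub_inf (\<lambda>v. (?A v / \<zeta> + ?B v / (\<zeta> - 1)) * d) w) (at z)"
    unfolding sub_inf_def by (rule pairing_deriv)
  also have "(\<lambda>v. (?A v / \<zeta> + ?B v / (\<zeta> - 1)) * d) = (\<lambda>v. d / \<zeta> * ?A v + d / (\<zeta> - 1) * ?B v)"
    by (simp add: field_simps)
  also have "sub_inf (\<lambda>v. d / \<zeta> * ?A v + d / (\<zeta> - 1) * ?B v) w
      = d / \<zeta> * (letter False \<odot> ?S) w + d / (\<zeta> - 1) * (- (letter False \<odot> ?S) w - (letter True \<odot> ?S) w)"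
  proof -
    have "sub_inf (letter True) = (\<lambda>w. - 1 * letter False w - letter True w)"
      by (simp add: sub_inf_letter_True fun_eq_iff)
    then have "sub_inf ?B w = - 1 * (letter False \<odot> ?S) w - (letter True \<odot> ?S) w"
      by (simp only: sub_inf_mult nc_mult_diff_left nc_mult_scale_left)
    then show ?thesis
      by (simp only: sub_inf_lin) (simp add: sub_inf_mult)
  qed
  also have "\<dots> = (d / \<zeta> - d / (\<zeta> - 1)) * (letter False \<odot> ?S) w + (- (d / (\<zeta> - 1))) * (letter True \<odot> ?S) w"
    by (simp add: algebra_simps)
  also have d1: "- (d / (\<zeta> - 1)) = 1 / (z - 1)"
  proof -
    have "\<zeta> - 1 = 1 / (z - 1)"
      using z by (simp add: \<zeta>_def divide_simps)
    then show ?thesis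
      using z by (simp add: d_def power2_eq_square)
  qed
  also have "d / \<zeta> - d / (\<zeta> - 1) = 1 / z"
  proof -
    have "d / \<zeta> = - 1 / (z * (z - 1))"
      using z by (simp add: d_def \<zeta>_def power2_eq_square)
    then have "d / \<zeta> - d / (\<zeta> - 1) = - 1 / (z * (z - 1)) + 1 / (z - 1)"
      using d1 by simp
    also have "\<dots> = 1 / z"
      using z by (simp add: divide_simps)
    finally show ?thesis .
  qed
  finally show "((\<lambda>z. sub_inf (X (z / (z - 1))) w) has_field_derivative
      (letter False \<odot> sub_inf (X (z / (z - 1)))) w / z + (letter True \<odot> sub_inf (X (z / (z - 1)))) w / (z - 1)) (at z)"
    by (simp add: \<zeta>_def)
qed

lemma Im_moebius: "Im (z / (z - 1)) = - Im z / ((Re z - 1)\<^sup>2 + (Im z)\<^sup>2)"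
proof (cases "z = 1")
  case False
  then have "z / (z - 1) = 1 + inverse (z - 1)"
    by (simp add: field_simps)
  then show ?thesis
    by simp
qed simp

lemma Im_Ln_neg:
  assumes "Im z < 0"
  shows "- pi < Im (Ln z)" "Im (Ln z) < 0"
proof -
  have z: "z \<noteq> 0"
    using assms by auto
  show "- pi < Im (Ln z)"
    by (rule mpi_less_Im_Ln[OF z])
  show "Im (Ln z) < 0"
    using Im_Ln_pos_le[OF z] Im_Ln_le_pi[OF z] assms by linarith
qed

text \<open>On the half plane with sign s the logarithms of z and 1 - z have imaginary parts of
  opposite sign. Their difference therefore lies within pi of s pi, and subtracting s pi i returns
  it to the principal branch.\<close>

lemma Ln_moebius:
  assumes s: "s = 1 \<or> s = - 1" and z: "0 < s * Im z"
  shows "Ln (z / (z - 1)) = Ln z - Ln (1 - z) - of_real (s * pi) * \<i>"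
proof (rule Ln_unique)
  have nz: "z \<noteq> 0" "1 - z \<noteq> 0"
    using z by auto
  have "exp (of_real (s * pi) * \<i>) = - 1"
    using s by (auto simp: exp_minus)
  then show "exp (Ln z - Ln (1 - z) - of_real (s * pi) * \<i>) = z / (z - 1)"
    using nz by (simp add: exp_diff minus_divide_right)
  have "- pi < Im (Ln z - Ln (1 - z) - of_real (s * pi) * \<i>) \<and> Im (Ln z - Ln (1 - z) - of_real (s * pi) * \<i>) \<le> pi"
    using s
  proof
    assume "s = 1"
    then have "0 < Im z" "Im (1 - z) < 0"
      using z by simp_all
    then show ?thesis
      using Im_Ln_pos_lt_imp[of z] Im_Ln_neg[of "1 - z"] \<open>s = 1\<close> by simp
  next
    assume "s = - 1"
    then have "Im z < 0" "0 < Im (1 - z)"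
      using z by simp_all
    then show ?thesis
      using Im_Ln_pos_lt_imp[of "1 - z"] Im_Ln_neg[of z] \<open>s = - 1\<close> by simp
  qed
  then show "- pi < Im (Ln z - Ln (1 - z) - of_real (s * pi) * \<i>)"
    "Im (Ln z - Ln (1 - z) - of_real (s * pi) * \<i>) \<le> pi"
    by simp_all
qed

lemma Ln_one_minus:
  assumes "s = 1 \<or> s = - 1" and "0 < s * Im z"
  shows "Ln (1 - z) = Ln (z - 1) - of_real (s * pi) * \<i>"
proof -
  have "z - 1 \<noteq> 0"
    using assms(2) by auto
  from Ln_minus[OF this] show ?thesis
    using assms by (auto simp: mult.commute)
qed

text \<open>Near 0 the map is close to -z, and Ln (- z) = Ln z - s pi i on this half plane. As the
  substitution fixes X_0, both sides have the same leading behaviour at 0 up to the half turn on the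
  right, and \<open>kz_sol_unique_at_0\<close> applies.\<close>

lemma sub_inf_Lser:
  assumes s: "s = 1 \<or> s = - 1" and z: "0 < s * Im z"
  shows "sub_inf (Lser (z / (z - 1))) = Lser z \<odot> nc_exp (- (of_real (s * pi) * \<i>)) False"
proof -
  let ?U = "{z. 0 < s * Im z}" and ?c = "of_real (s * pi) * \<i>"
  let ?X = "\<lambda>z. sub_inf (Lser (z / (z - 1))) \<odot> nc_exp ?c False"
  \<comment> \<open>Besides the half turn, Ln (z / (z - 1)) contributes - Ln (1 - z), which is
    holomorphic at 0 and is absorbed into the regular factor.\<close>
  let ?P = "\<lambda>z. sub_inf (Hser (z / (z - 1))) \<odot> nc_exp (- Ln (1 - z)) False"
  have U: "?U \<subseteq> doubly_slit_plane"
    by (auto simp: doubly_slit_plane_def)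
  have moebius: "z / (z - 1) \<in> doubly_slit_plane" if "z \<in> ?U" for z
  proof -
    have "Im z \<noteq> 0"
      using that by auto
    then have "(Re z - 1)\<^sup>2 + (Im z)\<^sup>2 > 0"
      by (intro add_nonneg_pos) auto
    then have "Im (z / (z - 1)) \<noteq> 0"
      using \<open>Im z \<noteq> 0\<close> unfolding Im_moebius by simp
    then show ?thesis
      by (simp add: doubly_slit_plane_def)
  qed
  have "?X z = Lser z"
  proof (rule kz_sol_unique_at_0[where U = ?U and P = ?P and Q = Hser])
    show "open ?U"
      by (intro open_Collect_less continuous_intros)
    have "?U = {z. 0 < Im z} \<or> ?U = {z. Im z < 0}"
      using s by auto
    then show "connected ?U"
      using convex_connected[OF convex_halfspace_Im_gt[of 0]] convex_connected[OF convex_halfspace_Im_lt[of 0]]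
      by (elim disjE) simp_all
    show "?U \<noteq> {}"
      using z by auto
    show "0 islimpt ?U"
      by (rule islimpt_ray[of "of_real s * \<i>"]) (use s in auto)
    show "kz_sol ?U ?X"
    proof (rule kz_sol_mult_const, rule kz_sol_sub_inf[OF kz_sol_Lser])
      fix z assume "z \<in> ?U"
      then show "z \<noteq> 0 \<and> z \<noteq> 1 \<and> z / (z - 1) \<in> doubly_slit_plane"
        using moebius by auto
    qed
    show "kz_sol ?U Lser"
      by (rule kz_sol_subset[OF kz_sol_Lser U])
    show "?X z = ?P z \<odot> nc_exp (Ln z) False" if "z \<in> ?U" for z
      using Ln_moebius[OF s, of z] that by (simp add: Lser_def sub_inf_mult nc_mult_assoc nc_exp_add)
    show "Lser z = Hser z \<odot> nc_exp (Ln z) False" for z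
      by (rule Lser_def)
    show "(\<lambda>z. ?P z v) field_differentiable at 0" for v
    proof (intro nc_mult_differentiable sub_inf_differentiable)
      fix v
      have "(\<lambda>z::complex. z / (z - 1)) field_differentiable at 0"
        by (intro derivative_intros field_differentiable_divide field_differentiable_diff) simp_all
      moreover have "(\<lambda>z. Hser z v) field_differentiable at (0 / (0 - 1))"
        using Hser_differentiable[OF zero_in_slit_plane] by simp
      ultimately show "(\<lambda>z. Hser (z / (z - 1)) v) field_differentiable at 0"
        using field_differentiable_compose[of "\<lambda>z. z / (z - 1)" 0 "\<lambda>z. Hser z v"] by (simp add: o_def)
    next
      fix v
      have "((\<lambda>z. - Ln (1 - z)) has_field_derivative 1) (at 0)"
        by (auto intro!: derivative_eq_intros)
      from nc_exp_deriv[OF this] show "(\<lambda>z. nc_exp (- Ln (1 - z)) False v) field_differentiable at 0"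
        unfolding field_differentiable_def by blast
    qed
    show "?P 0 = nc_one"
      by (simp add: Hser_0 nc_exp_0)
    show "(\<lambda>z. Hser z v) field_differentiable at 0" for v
      by (rule Hser_differentiable[OF zero_in_slit_plane])
  qed (use z in \<open>simp_all add: Hser_0\<close>)
  then have "?X z \<odot> nc_exp (- ?c) False = Lser z \<odot> nc_exp (- ?c) False"
    by simp
  then show ?thesis
    by (simp add: nc_mult_assoc nc_exp_add nc_exp_0)
qed

text \<open>The boundary values at 2 of the KZ solution, from the upper (\<open>s = 1\<close>) and from the lower
  (\<open>s = - 1\<close>) half plane; 2 is the fixed point of \<open>z \<mapsto> z / (z - 1)\<close>.\<close>

definition Lser_at_2 :: "real \<Rightarrow> word \<Rightarrow> complex" where
  "Lser_at_2 s = swap (Hser (- 1)) \<odot> nc_exp (- (of_real (s * pi) * \<i>)) True \<odot> Phi"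

text \<open>The limit of \<open>sub_inf_Lser\<close> as z tends to 2 within the half plane s. The
  argument z / (z - 1) then tends to 2 from the opposite half plane, which explains the two
  signs.\<close>

lemma sub_inf_Lser_at_2:
  assumes s: "s = 1 \<or> s = - 1"
  shows "sub_inf (Lser_at_2 (- s)) = Lser_at_2 s \<odot> nc_exp (- (of_real (s * pi) * \<i>)) False"
proof -
  \<comment> \<open>Ln (1 - z) jumps across the cut at 2, whereas Ln (z - 1) - s pi i is continuous
    there and agrees with it on the half plane s.\<close>
  define A where "A s z = swap (Hser (1 - z)) \<odot> nc_exp (Ln (z - 1) - of_real (s * pi) * \<i>) True \<odot> Phi" for s :: real and z
  have A_2: "A s 2 = Lser_at_2 s" for s
    by (simp add: A_def Lser_at_2_def)
  have L: "Lser z = A s z" if "s = 1 \<or> s = - 1" "0 < s * Im z" for s z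
  proof -
    have "z \<in> doubly_slit_plane"
      using that by (auto simp: doubly_slit_plane_def)
    then show ?thesis
      using Ln_one_minus[OF that] by (simp add: Lser_connection[of z] swap_Lser A_def)
  qed
  have cont: "isCont (\<lambda>z. A s z v) 2" for s v
    unfolding A_def
  proof (intro nc_mult_isCont nc_exp_isCont)
    fix v
    have "isCont (\<lambda>z. Hser z (map Not v)) (1 - 2)"
      by (rule field_differentiable_imp_continuous_at, rule Hser_differentiable) (simp add: slit_plane_def)
    moreover have "isCont (\<lambda>z::complex. 1 - z) 2"
      by (intro continuous_intros)
    ultimately show "isCont (\<lambda>z. swap (Hser (1 - z)) v) 2"
      unfolding swap_def using isCont_o2[of 2 "\<lambda>z. 1 - z" "\<lambda>z. Hser z (map Not v)"] by simp
    show "isCont (\<lambda>z. Ln (z - 1) - of_real (s * pi) * \<i>) 2"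
      by (intro continuous_diff isCont_Ln' continuous_ident continuous_const) (simp add: complex_nonpos_Reals_iff)
  qed (rule continuous_const)
  have sub_cont: "isCont (\<lambda>z. sub_inf (A (- s) (z / (z - 1))) w) 2" for w
    unfolding sub_inf_def
  proof (rule pairing_isCont)
    fix v
    have "isCont (\<lambda>z::complex. z / (z - 1)) 2"
      by (intro continuous_intros) simp
    then show "isCont (\<lambda>z. A (- s) (z / (z - 1)) v) 2"
      using isCont_o2[of 2 "\<lambda>z. z / (z - 1)" "\<lambda>z. A (- s) z v"] cont by simp
  qed
  let ?R = "nc_exp (- (of_real (s * pi) * \<i>)) False" and ?U = "{z. 0 < s * Im z}"
  have "sub_inf (A (- s) 2) w = (A s 2 \<odot> ?R) w" for w
  proof (rule tendsto_unique[of "at 2 within ?U"])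
    have "2 islimpt ?U"
      by (rule islimpt_ray[of "of_real s * \<i>"]) (use s in auto)
    then show "at 2 within ?U \<noteq> bot"
      by (simp add: trivial_limit_within)
    have "((\<lambda>z. sub_inf (A (- s) (z / (z - 1))) w) \<longlongrightarrow> sub_inf (A (- s) (2 / (2 - 1))) w) (at 2 within ?U)"
      using sub_cont[of w] by (auto simp: isCont_def intro: tendsto_within_subset[of _ _ 2 UNIV])
    then show "((\<lambda>z. sub_inf (A (- s) (z / (z - 1))) w) \<longlongrightarrow> sub_inf (A (- s) 2) w) (at 2 within ?U)"
      by simp
    have "isCont (\<lambda>z. (A s z \<odot> ?R) w) 2"
      by (intro nc_mult_isCont cont continuous_const)
    then have "((\<lambda>z. (A s z \<odot> ?R) w) \<longlongrightarrow> (A s 2 \<odot> ?R) w) (at 2 within ?U)"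
      by (auto simp: isCont_def intro: tendsto_within_subset[of _ _ 2 UNIV])
    moreover have "\<forall>\<^sub>F z in at 2 within ?U. (A s z \<odot> ?R) w = sub_inf (A (- s) (z / (z - 1))) w"
      unfolding eventually_at_filter
    proof (intro always_eventually allI impI)
      fix z assume "z \<in> ?U"
      then have z: "0 < s * Im z"
        by simp
      have "(Re z - 1)\<^sup>2 + (Im z)\<^sup>2 > 0"
        using z by (intro add_nonneg_pos) auto
      then have "0 < - s * Im (z / (z - 1))"
        using z unfolding Im_moebius by simp
      then have "Lser (z / (z - 1)) = A (- s) (z / (z - 1))"
        using s by (intro L) auto
      then show "(A s z \<odot> ?R) w = sub_inf (A (- s) (z / (z - 1))) w"
        using sub_inf_Lser[OF s z] L[OF s z] by simp
    qed
    ultimately show "((\<lambda>z. sub_inf (A (- s) (z / (z - 1))) w) \<longlongrightarrow> (A s 2 \<odot> ?R) w) (at 2 within ?U)"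
      by (rule Lim_transform_eventually)
  qed
  then show ?thesis
    by (simp only: A_2) (rule ext)
qed

text \<open>Since \<open>swap Phi\<close> is the inverse of \<open>Phi\<close>, this is exp(c X_1)
  conjugated by the connection matrix; for c = 2 pi i it is the monodromy around 1 as seen from
  0.\<close>

definition loop_1 :: "complex \<Rightarrow> word \<Rightarrow> complex" where
  "loop_1 c = swap Phi \<odot> nc_exp c True \<odot> Phi"

lemma Phi_mult_swap: "Phi \<odot> (swap Phi \<odot> F) = F"
proof -
  have "Phi \<odot> swap Phi = swap (swap Phi \<odot> Phi)"
    by (simp add: swap_mult)
  also have "\<dots> = nc_one"
    by (simp add: swap_Phi_mult)
  finally show ?thesis
    by (simp flip: nc_mult_assoc)
qed

text \<open>The values on both sides of the cut differ by the factor exp(2 s pi i X_1) inside,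
  because - s pi + 2 s pi = s pi; conjugation by \<open>Phi\<close> moves it to the right
  end.\<close>

lemma Lser_at_2_loop:
  "Lser_at_2 s \<odot> loop_1 (of_real (2 * s * pi) * \<i>) = Lser_at_2 (- s)"
proof -
  have "Lser_at_2 s \<odot> loop_1 (of_real (2 * s * pi) * \<i>) = swap (Hser (- 1)) \<odot>
      ((nc_exp (- (of_real (s * pi) * \<i>)) True \<odot> nc_exp (of_real (2 * s * pi) * \<i>) True) \<odot> Phi)"
    by (simp only: Lser_at_2_def loop_1_def nc_mult_assoc Phi_mult_swap)
  also have "\<dots> = Lser_at_2 (- s)"
  proof -
    have "- (of_real (s * pi) * \<i>) + of_real (2 * s * pi) * \<i> = - (of_real (- s * pi) * \<i>)"
      by (simp add: algebra_simps)
    then show ?thesis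
      by (simp only: nc_exp_add Lser_at_2_def nc_mult_assoc)
  qed
  finally show ?thesis .
qed

lemma PhiRS_eq: "PhiRS = nc_exp (pi * \<i> / 2) False \<odot> loop_1 (2 * pi * \<i>) \<odot> nc_exp (pi * \<i> / 2) False"
proof -
  have "PhiKZ_swap = swap Phi"
    by (simp add: PhiKZ_swap_def swap_def PhiKZ_eq fun_eq_iff)
  then show ?thesis
    by (simp add: PhiRS_def loop_1_def PhiKZ_eq nc_mult_assoc)
qed

lemma cnj_Phi: "cnj (Phi w) = Phi w"
  by (simp add: PhiKZ_def flip: PhiKZ_eq)

lemma cnj_PhiRS_eq:
  "(\<lambda>w. cnj (PhiRS w)) = nc_exp (- (pi * \<i> / 2)) False \<odot> loop_1 (- (2 * pi * \<i>)) \<odot> nc_exp (- (pi * \<i> / 2)) False"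
proof -
  have "(\<lambda>w. cnj (swap Phi w)) = swap Phi"
    by (simp add: swap_def cnj_Phi fun_eq_iff)
  then show ?thesis
    by (simp add: PhiRS_eq loop_1_def cnj_nc_mult cnj_nc_exp cnj_Phi)
qed

lemma PhiRS_sub_inf: "sub_inf (\<lambda>w. cnj (PhiRS w)) = PhiRS"
proof -
  let ?E = "\<lambda>c. nc_exp c False" and ?L = Lser_at_2
  let ?p = "pi * \<i> / 2 :: complex"
  let ?P = "loop_1 (2 * pi * \<i>)" and ?Q = "sub_inf (loop_1 (- (2 * pi * \<i>)))"
  \<comment> \<open>The substituted ?L 1 is evaluated twice, through ?L (- 1) and the inverse loop,
    and directly. Cancelling ?L 1 leaves a relation between loops only.\<close>
  have "?L 1 \<odot> (?E (- (pi * \<i>)) \<odot> ?Q) = sub_inf (?L (- 1) \<odot> loop_1 (- (2 * pi * \<i>)))"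
    using sub_inf_Lser_at_2[of 1] by (simp add: sub_inf_mult nc_mult_assoc)
  also have "\<dots> = sub_inf (?L 1)"
    using Lser_at_2_loop[of "- 1"] by simp
  also have "\<dots> = ?L (- 1) \<odot> ?E (pi * \<i>)"
    using sub_inf_Lser_at_2[of "- 1"] by simp
  also have "\<dots> = ?L 1 \<odot> (?P \<odot> ?E (pi * \<i>))"
    using Lser_at_2_loop[of 1] by (simp flip: nc_mult_assoc)
  finally have Q: "?E (- (pi * \<i>)) \<odot> ?Q = ?P \<odot> ?E (pi * \<i>)"
    by (rule nc_mult_left_cancel[rotated]) (simp add: Lser_at_2_def swap_def nc_charD(1)[OF nc_char_Phi])
  have "sub_inf (\<lambda>w. cnj (PhiRS w)) = ?E (- ?p) \<odot> ?Q \<odot> ?E (- ?p)"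
    by (simp add: cnj_PhiRS_eq sub_inf_mult)
  \<comment> \<open>Writing - pi i / 2 as pi i / 2 - pi i brings the left side of Q into view; on
    the right the exponents then add up to pi i / 2 again.\<close>
  also have "?E (- ?p) = ?E ?p \<odot> ?E (- (pi * \<i>))"
    unfolding nc_exp_add by (simp add: field_simps)
  also have "?E ?p \<odot> ?E (- (pi * \<i>)) \<odot> ?Q \<odot> (?E ?p \<odot> ?E (- (pi * \<i>))) = ?E ?p \<odot> (?P \<odot> (?E (pi * \<i>) \<odot> (?E ?p \<odot> ?E (- (pi * \<i>)))))"
    using Q by (simp add: nc_mult_assoc[of "?E ?p"]) (simp add: nc_mult_assoc)
  also have "\<dots> = PhiRS"
  proof -
    have "pi * \<i> + (?p + - (pi * \<i>)) = ?p"
      by simp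
    then show ?thesis
      by (simp only: nc_exp_add PhiRS_eq nc_mult_assoc)
  qed
  finally show ?thesis .
qed

section \<open>Generating series of star values\<close>

abbreviation word_letter :: "bool \<Rightarrow> complex \<times> complex" where
  "word_letter b \<equiv> if b then E1 else E0"

lemma pairing_word_letters: "pairing F (map word_letter w) = F w"
  by (induction w arbitrary: F) auto

lemma pairing_word_letters_left: "pairing F (map word_letter w @ x) = pairing (\<lambda>v. F (w @ v)) x"
  by (simp add: pairing_append pairing_word_letters)

lemma pairing_infix: "pairing (\<lambda>w. F (u @ w @ v)) x = pairing F (map word_letter u @ x @ map word_letter v)"
  unfolding pairing_word_letters_left
  by (simp add: pairing_append[of _ x] pairing_word_letters)

lemma zRS_star_eq:
  assumes "k \<noteq> []" "index k"
  shows "zRS_star k a b = - ((-1) ^ (wt k + a + b) / (2 * pi * \<i>)) *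
    pairing PhiRS (replicate a E0 @ E1 # map star_letter (gaps k) @ E1 # replicate b E0)"
proof -
  let ?F = "\<lambda>w. PhiRS ((replicate a False @ [True]) @ w @ (True # replicate b False))"
  let ?c = "(-1) ^ (wt k + a + b) / (2 * pi * \<i>) :: complex"
  have "zRS l a b = ?c * ((-1) ^ dep l * ?F (gaps l))" if "l \<in> set (coarsenings k)" for l
    using coarsenings_index[OF assms that] by (simp add: zRS_def omega_eq power_add)
  then have "zRS_star k a b = (\<Sum>l\<leftarrow>coarsenings k. ?c * ((-1) ^ dep l * ?F (gaps l)))"
    unfolding zRS_star_def by (intro arg_cong[where f = sum_list] map_cong refl)
  also have "\<dots> = ?c * (- pairing ?F (map star_letter (gaps k)))"
    by (simp only: sum_list_const_mult coarsenings_sum[OF assms, of ?F])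
  also have "pairing ?F (map star_letter (gaps k)) =
      pairing PhiRS (replicate a E0 @ E1 # map star_letter (gaps k) @ E1 # replicate b E0)"
    unfolding pairing_infix by simp
  finally show ?thesis
    by simp
qed

lemma index_ones: "index k \<Longrightarrow> index (ones m @ k @ ones n)"
  by (auto simp: index_def ones_def)

lemma wt_ones: "wt (ones m @ k @ ones n) = m + wt k + n"
  by (simp add: wt_def ones_def sum_list_replicate)

lemma gaps_ones:
  assumes "k \<noteq> []"
  shows "gaps (ones m @ k @ ones n) = replicate m True @ gaps k @ replicate n True"
proof -
  have "gaps (k @ ones n) = gaps k @ replicate n True"
  proof (induction n)
    case (Suc n)
    have "k @ ones (Suc n) = (k @ ones n) @ [1]"
      by (simp add: ones_def replicate_append_same)
    then have "gaps (k @ ones (Suc n)) = gaps (k @ ones n) @ [True]"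
      using gaps_snoc_1[of "k @ ones n"] assms by simp
    then show ?case
      using Suc by (simp add: replicate_append_same)
  qed (simp add: ones_def)
  then show ?thesis
    using assms by (induction m) (simp_all add: ones_def gaps_Cons)
qed

text \<open>The expansion of a product with outer factors e_0^(a+1) - (e_0 - e_1)^(a+1) and
  e_0^(b+1) - (e_0 - e_1)^(b+1). Exchanging e_0 and e_0 - e_1 negates both, so only the word in the
  middle changes.\<close>

definition bracket :: "(word \<Rightarrow> complex) \<Rightarrow> nat \<Rightarrow> nat \<Rightarrow> bool list \<Rightarrow> complex" where
  "bracket F a b g = (let P = \<lambda>x y. pairing F (replicate (Suc a) x @ map star_letter g @ replicate (Suc b) y)
    in P E0 E0 - P E0 Ediff - P Ediff E0 + P Ediff Ediff)"

text \<open>Expresses \<open>(1 + e\<^sub>0 s)\<^bsup>-1\<^esup> e\<^sub>1 s (1 + (e\<^sub>0 - e\<^sub>1) s)\<^bsup>-1\<^esup> =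
  (1 + (e\<^sub>0 - e\<^sub>1) s)\<^bsup>-1\<^esup> - (1 + e\<^sub>0 s)\<^bsup>-1\<^esup>\<close> on coefficients, and similarly for \<open>t\<close>.\<close>

lemma gen_series_zRS_star:
  assumes "k \<noteq> []" "index k"
  shows "gen_series (\<lambda>m n. zRS_star (ones m @ k @ ones n)) a b =
    - ((-1) ^ (wt k + a + b) / (2 * pi * \<i>)) * bracket PhiRS a b (gaps k)"
proof -
  let ?x = "map star_letter (gaps k)"
  let ?c = "- ((-1) ^ (wt k + a + b) / (2 * pi * \<i>)) :: complex"
  have "zRS_star (ones m @ k @ ones n) (a - m) (b - n) = ?c * pairing PhiRS (replicate (a - m) E0 @ E1 #
      replicate m Ediff @ ?x @ replicate n Ediff @ E1 # replicate (b - n) E0)" if "m \<le> a" "n \<le> b" for m n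
  proof -
    \<comment> \<open>The added ones raise the weight by exactly what the exponents of s and t lose,
      so the sign is the same for all m and n.\<close>
    have "wt (ones m @ k @ ones n) + (a - m) + (b - n) = wt k + a + b"
      using that by (simp add: wt_ones)
    then show ?thesis
      using zRS_star_eq[of "ones m @ k @ ones n" "a - m" "b - n"] assms
      by (simp add: index_ones gaps_ones star_letter_def[of True])
  qed
  then have "gen_series (\<lambda>m n. zRS_star (ones m @ k @ ones n)) a b =
      (\<Sum>m\<le>a. \<Sum>n\<le>b. ?c * pairing PhiRS (replicate (a - m) E0 @ E1 #
        replicate m Ediff @ ?x @ replicate n Ediff @ E1 # replicate (b - n) E0))"
    unfolding gen_series_def by (intro sum.cong refl) simp
  \<comment> \<open>The sum over m moves inside, where it telescopes for each n; the sum over n then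
    telescopes in both resulting terms.\<close>
  also have "\<dots> = ?c * (\<Sum>n\<le>b. \<Sum>m\<le>a. pairing PhiRS (replicate (a - m) E0 @ E1 #
        replicate m Ediff @ ?x @ replicate n Ediff @ E1 # replicate (b - n) E0))"
    unfolding sum_distrib_left by (rule sum.swap)
  also have "\<dots> = ?c * (\<Sum>n\<le>b.
      pairing PhiRS ((replicate (Suc a) E0 @ ?x) @ replicate n Ediff @ E1 # replicate (b - n) E0)
      - pairing PhiRS ((replicate (Suc a) Ediff @ ?x) @ replicate n Ediff @ E1 # replicate (b - n) E0))"
    by (simp only: pairing_telescope_left append_assoc)
  also have "\<dots> = ?c * bracket PhiRS a b (gaps k)"
    unfolding sum_subtractf pairing_telescope_right bracket_def Let_def by simp
  finally show ?thesis .
qed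

lemma bracket_sub_inf: "bracket (sub_inf F) a b g = bracket F a b (map Not g)"
proof -
  have "(\<lambda>(p, q). (p, - p - q)) \<circ> star_letter = star_letter \<circ> Not"
    by (auto simp: star_letter_def fun_eq_iff)
  then show ?thesis
    by (simp add: bracket_def pairing_sub_inf o_assoc del: replicate_Suc)
qed

lemma cnj_pairing: "cnj (pairing F x) = pairing (\<lambda>w. cnj (F w)) (map (map_prod cnj cnj) x)"
proof (induction x arbitrary: F)
  case (Cons pq x)
  then show ?case
    by (cases pq) simp
qed simp

lemma cnj_bracket: "cnj (bracket F a b g) = bracket (\<lambda>w. cnj (F w)) a b g"
proof -
  have "map_prod cnj cnj \<circ> star_letter = star_letter"
    by (auto simp: star_letter_def fun_eq_iff)
  then show ?thesis
    by (simp add: bracket_def cnj_pairing del: replicate_Suc)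
qed

theorem theorem5p5:
  fixes k :: "nat list"
  assumes "k \<noteq> []" and "index k"
  shows "\<forall>a b. gen_series (\<lambda>m n. zRS_star (ones m @ k @ ones n)) a b
            = - gen_series (\<lambda>m n c d. cnj (zRS_star (ones m @ dual k @ ones n) c d)) a b"
proof (intro allI)
  fix a b
  have "gen_series (\<lambda>m n c d. cnj (zRS_star (ones m @ dual k @ ones n) c d)) a b =
      cnj (gen_series (\<lambda>m n. zRS_star (ones m @ dual k @ ones n)) a b)"
    by (simp add: gen_series_def)
  \<comment> \<open>The minus sign of the theorem originates here: conjugation negates 1 / (2 pi i),
    while the weight, and so its sign, is the same for the dual index.\<close>
  also have "\<dots> = (-1) ^ (wt k + a + b) / (2 * pi * \<i>) * bracket (\<lambda>w. cnj (PhiRS w)) a b (map Not (gaps k))"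
    by (simp add: gen_series_zRS_star[OF dual_nonempty index_dual] gaps_dual wt_dual assms cnj_bracket)
  also have "bracket (\<lambda>w. cnj (PhiRS w)) a b (map Not (gaps k)) = bracket PhiRS a b (gaps k)"
    by (simp add: PhiRS_sub_inf flip: bracket_sub_inf)
  finally show "gen_series (\<lambda>m n. zRS_star (ones m @ k @ ones n)) a b
      = - gen_series (\<lambda>m n c d. cnj (zRS_star (ones m @ dual k @ ones n) c d)) a b"
    by (simp add: gen_series_zRS_star[OF assms])
qed

end
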